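(* Assume independent risk factors ($\rho=0$) and constant market price of interest rate risk ($a=\kappa$). Let $T>0$ be given. The extremal pairs of strategies are the pairs $(f^r,f^S)$ for which there is one and the same value $\nu\ne1/2$ such that $$f^r_s=\frac{\lambda^r+2\nu\,\sigma_r\Psi(\kappa,T-s)}{1-2\nu}\qquad(0\le s\le T),$$ and $f^S$ is an extremal equity strategy with Lagrange multiplier $\nu$. Writing $R=\sigma_x/\sigma_S$, $\tilde R=R-\alpha$, $A=1-2\nu$, $C=2\nu(\alpha-R)^2-\alpha^2$, $D=\alpha^2\bar x/\sigma_S$, the latter is given (whenever the matrix to be inverted, respectively the denominator, in the relevant formula below is non-singular) by: (0) If $\nu=0$: $f^S_s=\frac{\bar x}{\sigma_S}+e^{-\alpha s}\frac{x_0-\bar x}{\sigma_S}$. (I) If $\nu\neq0$ and either $C<0<A$ or $A<0<C$: $f^S_s=b_0+b_1e^{c_1s}+b_2e^{c_2s}$ with $b_0=-D/C$, $c_1=\sqrt{-C/A}$, $c_2=-c_1$, where for $\alpha\neq\frac12R$ $$\begin{pmatrix}b_1\\ b_2\end{pmatrix}=\begin{pmatrix}\frac{e^{c_1T}}{c_1-\alpha}&\frac{e^{c_2T}}{c_2-\alpha}\\ \frac{\sigma_x}{\sigma_S(c_1+\alpha)-\sigma_x}&\frac{\sigma_x}{\sigma_S(c_2+\alpha)-\sigma_x}\end{pmatrix}^{-1}\begin{pmatrix}\frac{\alpha\bar x}{\sigma_S\left(\alpha^2-2\nu(\alpha-R)^2\right)}\\ -\frac{x_0}{\sigma_S}+\frac{\alpha\bar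 x}{\sigma_S}\frac{\alpha-2\nu(\alpha-R)}{\alpha^2-2\nu(\alpha-R)^2}\end{pmatrix},$$ and for $\alpha=\frac12R$ (in which case $c_1=\alpha$, $c_2=-\alpha$) $$b_1=0,\qquad b_2=\frac{-\frac{x_0}{\sigma_S}+\frac{\bar x}{\sigma_S}\left(1-\frac{4\nu}{1-2\nu}(e^{-\alpha T}-1)\right)}{2\nu e^{-2\alpha T}-1}.$$ (II) If $A$ and $C$ are both negative or both positive: $f^S_s=b_0+b_1\sin(cs)+b_2\cos(cs)$ with $b_0=-D/C$, $c=\sqrt{C/A}$, and $$\begin{pmatrix}b_1\\ b_2\end{pmatrix}=\begin{pmatrix}\alpha\sin(cT)+c\cos(cT)&\alpha\cos(cT)-c\sin(cT)\\ c&\tilde R\end{pmatrix}^{-1}\begin{pmatrix}\frac{\alpha\bar x}{\sigma_S}\left[A^{-1}+\alpha^2C^{-1}\right]\\ \frac{x_0}{\sigma_x}\left[c^2+\tilde R^2\right]+\frac{\alpha\bar x}{\sigma_S}\left[A^{-1}+\alpha\tilde RC^{-1}\right]\end{pmatrix}.$$ (III) If $\nu\neq0$, $C=0$ and $A\ne0$: $f^S_s=b_0+b_1s+b_2s^2$ with $b_2=-D/(2A)$ and $$\begin{pmatrix}b_0\\ b_1\end{pmatrix}=\begin{pmatrix}\alpha&T\alpha+1\\ \frac{\sigma_x}{\sigma_S}&\frac{\sigma_x}{\sigma_x-\sigma_S\alpha}\end{pmatrix}^{-1}\begin{pmatrix}\frac{\bar x\alpha}{\sigma_S(1-2\nu)}\left[\frac12T^2\alpha^2+T\alpha+1\right]\\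 \frac{x_0}{\sigma_S}\tilde R+\frac{\bar x\alpha}{\sigma_S(1-2\nu)}\frac{\sigma_x}{\sigma_S}\tilde R^{-1}\end{pmatrix}.$$ For $\nu<0$, the pairs are optimal strategies with positive mean-variance trade-off.
   Context: Parameters: $\kappa,\bar r,b,r_0,\alpha,\bar x,x_0\in\mathbb{R}$ and $\sigma_r,\sigma_x,\sigma_S>0$; $\lambda^r=\kappa(\bar r-b)/\sigma_r$; $\Psi(k,t)=\int_0^te^{-ku}du$; $m^0_T=T\bar r+(r_0-\bar r)\Psi(\kappa,T)$; $\xi_s=\frac1{\sigma_S}\left(\bar x+e^{-\alpha s}(x_0-\bar x)\right)$. A pair of strategies is a pair $(f^r,f^S)$ of continuous deterministic functions $[0,T]\to\mathbb{R}$ (exposures to interest rate and equity risk). Set $$\mu_T=m^0_T+\int_0^T\left(\lambda^rf^r_s-\tfrac12(f^r_s)^2\right)ds+\int_0^T\left(\xi_sf^S_s-\tfrac12(f^S_s)^2\right)ds,$$ $$\sigma_T^2=\int_0^T\left[\sigma_r\Psi(\kappa,T-u)+f^r_u\right]^2du+\int_0^T\left[f^S_u-\frac{\sigma_x}{\sigma_S}\int_u^Tf^S_se^{-\alpha(s-u)}ds\right]^2du .$$ When the correlation $\rho$ of the two driving Brownian motions is $0$ and $a=\kappa$ (where $a,b$ are the Vasicek pricing parameters of the bond market), these are the mean and variance of the log portfolio return $\log(V_T/V_0)$. A pair is extremal (a stationary point of the problem of extremizing $\mu_T$ for given $\sigma_T^2$) if there is a Lagrange multiplier $\nu\in\mathbb{R}$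 such that the first variation of $\mu_T+\nu\sigma_T^2$ at $(f^r,f^S)$ vanishes in every direction $(\eta^r,\eta^S)$ of continuous functions. A pair is optimal if it maximizes $\mu_T$ among all pairs with the same value of $\sigma_T^2$; positive mean-variance trade-off means that the trade-off $-\nu$ is positive. An extremal equity strategy with Lagrange multiplier $\nu$ is a continuous $f^S$ at which the first variation of $\int_0^T(\xi_sf^S_s-\frac12(f^S_s)^2)ds+\nu\int_0^T[f^S_u-\frac{\sigma_x}{\sigma_S}\int_u^Tf^S_se^{-\alpha(s-u)}ds]^2du$ vanishes in every continuous direction; equivalently $\xi_s-f^S_s+2\nu h_s-2\nu\frac{\sigma_x}{\sigma_S}\int_0^sh_ue^{-\alpha(s-u)}du=0$ on $[0,T]$ with $h_u=f^S_u-\frac{\sigma_x}{\sigma_S}\int_u^Tf^S_se^{-\alpha(s-u)}ds$. *)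

theory Defs
  imports "HOL-Analysis.Analysis"
begin

text \<open>
  Bond market of Vasicek type plus one stock with mean-reverting risk premium.  The standing
  assumptions that the two driving Brownian motions are independent and that the Vasicek pricing
  parameter \<open>a\<close> coincides with \<open>\<kappa>\<close> are built into the formulas below, so neither the correlation
  nor \<open>a\<close> appears as a parameter.  The paper's \<open>b\<close>, \<open>r\<^sub>0\<close>, \<open>x\<^sub>0\<close> are the fields
  \<open>bprice\<close>, \<open>rinit\<close>, \<open>xinit\<close>.
\<close>

record market =
  kappa :: real
  rbar :: real
  bprice :: real
  rinit :: real
  alpha :: real
  xbar :: real
  xinit :: real
  sigma_r :: real
  sigma_x :: real
  sigma_S :: real

definition lambda_r :: "market \<Rightarrow> real" where
  "lambda_r p = kappa p * (rbar p - bprice p) / sigma_r p"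

text \<open>Only used for \<open>t \<ge> 0\<close>; for \<open>t < 0\<close> the set integral is \<open>0\<close>, not the oriented integral.\<close>

definition Psi :: "real \<Rightarrow> real \<Rightarrow> real" where
  "Psi k t = integral {0..t} (\<lambda>u. exp (- k * u))"

definition m0 :: "market \<Rightarrow> real \<Rightarrow> real" where
  "m0 p T = T * rbar p + (rinit p - rbar p) * Psi (kappa p) T"

definition xi :: "market \<Rightarrow> real \<Rightarrow> real" where
  "xi p s = (1 / sigma_S p) * (xbar p + exp (- alpha p * s) * (xinit p - xbar p))"

definition rate_mean :: "market \<Rightarrow> real \<Rightarrow> (real \<Rightarrow> real) \<Rightarrow> real" where
  "rate_mean p T fr = integral {0..T} (\<lambda>s. lambda_r p * fr s - (1/2) * (fr s)\<^sup>2)"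

definition equity_mean :: "market \<Rightarrow> real \<Rightarrow> (real \<Rightarrow> real) \<Rightarrow> real" where
  "equity_mean p T fS = integral {0..T} (\<lambda>s. xi p s * fS s - (1/2) * (fS s)\<^sup>2)"

definition rate_var :: "market \<Rightarrow> real \<Rightarrow> (real \<Rightarrow> real) \<Rightarrow> real" where
  "rate_var p T fr = integral {0..T} (\<lambda>u. (sigma_r p * Psi (kappa p) (T - u) + fr u)\<^sup>2)"

definition equity_var :: "market \<Rightarrow> real \<Rightarrow> (real \<Rightarrow> real) \<Rightarrow> real" where
  "equity_var p T fS =
     integral {0..T} (\<lambda>u. (fS u - sigma_x p / sigma_S p *
                             integral {u..T} (\<lambda>s. fS s * exp (- alpha p * (s - u))))\<^sup>2)"

definition mu :: "market \<Rightarrow> real \<Rightarrow> (real \<Rightarrow> real) \<Rightarrow> (real \<Rightarrow> real) \<Rightarrow> real" where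
  "mu p T fr fS = m0 p T + rate_mean p T fr + equity_mean p T fS"

text \<open>The variance itself, i.e. \<open>\<sigma>\<^sub>T\<^sup>2\<close>, not the standard deviation.\<close>

definition sigma2 :: "market \<Rightarrow> real \<Rightarrow> (real \<Rightarrow> real) \<Rightarrow> (real \<Rightarrow> real) \<Rightarrow> real" where
  "sigma2 p T fr fS = rate_var p T fr + equity_var p T fS"

text \<open>
  Strategies are functions on all of \<open>\<real>\<close> of which only the values on \<open>[0,T]\<close> matter.
\<close>

definition strategy_pair :: "real \<Rightarrow> (real \<Rightarrow> real) \<Rightarrow> (real \<Rightarrow> real) \<Rightarrow> bool" where
  "strategy_pair T fr fS \<longleftrightarrow> continuous_on {0..T} fr \<and> continuous_on {0..T} fS"

definition lagrange_multiplier ::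
  "market \<Rightarrow> real \<Rightarrow> (real \<Rightarrow> real) \<Rightarrow> (real \<Rightarrow> real) \<Rightarrow> real \<Rightarrow> bool" where
  "lagrange_multiplier p T fr fS \<nu> \<longleftrightarrow>
     (\<forall>\<eta>r \<eta>S. strategy_pair T \<eta>r \<eta>S \<longrightarrow>
        ((\<lambda>\<epsilon>. mu p T (\<lambda>s. fr s + \<epsilon> * \<eta>r s) (\<lambda>s. fS s + \<epsilon> * \<eta>S s)
              + \<nu> * sigma2 p T (\<lambda>s. fr s + \<epsilon> * \<eta>r s) (\<lambda>s. fS s + \<epsilon> * \<eta>S s))
          has_real_derivative 0) (at 0))"

definition extremal_pair ::
  "market \<Rightarrow> real \<Rightarrow> (real \<Rightarrow> real) \<Rightarrow> (real \<Rightarrow> real) \<Rightarrow> bool" where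
  "extremal_pair p T fr fS \<longleftrightarrow>
     strategy_pair T fr fS \<and> (\<exists>\<nu>. lagrange_multiplier p T fr fS \<nu>)"

definition extremal_equity_strategy ::
  "market \<Rightarrow> real \<Rightarrow> real \<Rightarrow> (real \<Rightarrow> real) \<Rightarrow> bool" where
  "extremal_equity_strategy p T \<nu> fS \<longleftrightarrow>
     continuous_on {0..T} fS \<and>
     (\<forall>\<eta>. continuous_on {0..T} \<eta> \<longrightarrow>
        ((\<lambda>\<epsilon>. equity_mean p T (\<lambda>s. fS s + \<epsilon> * \<eta> s)
              + \<nu> * equity_var p T (\<lambda>s. fS s + \<epsilon> * \<eta> s))
          has_real_derivative 0) (at 0))"

definition optimal_pair ::
  "market \<Rightarrow> real \<Rightarrow> (real \<Rightarrow> real) \<Rightarrow> (real \<Rightarrow> real) \<Rightarrow> bool" where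
  "optimal_pair p T fr fS \<longleftrightarrow>
     strategy_pair T fr fS \<and>
     (\<forall>gr gS. strategy_pair T gr gS \<longrightarrow> sigma2 p T gr gS = sigma2 p T fr fS \<longrightarrow>
        mu p T gr gS \<le> mu p T fr fS)"

text \<open>
  The trade-off of an extremal pair is \<open>- \<nu>\<close> for its Lagrange multiplier \<open>\<nu>\<close>.  To avoid presupposing
  that the multiplier is unique, positivity is demanded of every multiplier (and there must be one).
\<close>

definition positive_tradeoff ::
  "market \<Rightarrow> real \<Rightarrow> (real \<Rightarrow> real) \<Rightarrow> (real \<Rightarrow> real) \<Rightarrow> bool" where
  "positive_tradeoff p T fr fS \<longleftrightarrow>
     extremal_pair p T fr fS \<and> (\<forall>\<nu>. lagrange_multiplier p T fr fS \<nu> \<longrightarrow> - \<nu> > 0)"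

definition mat22 :: "real \<Rightarrow> real \<Rightarrow> real \<Rightarrow> real \<Rightarrow> real^2^2" where
  "mat22 a b c d = vector [vector [a, b], vector [c, d]]"

definition vec2 :: "real \<Rightarrow> real \<Rightarrow> real^2" where
  "vec2 a b = vector [a, b]"

end

theory Submission
  imports Defs
begin

text \<open>
  The functional \<open>\<mu> + \<nu> \<sigma>\<^sup>2\<close> is quadratic in the pair of strategies, so its first variation is the
  pairing with a gradient, computed by moving the integral operator in the variance onto the other
  factor.  The rate equation is pointwise and determines \<open>f\<^sup>r\<close> and \<open>\<nu>\<close>.  The equity equation
  \<open>A f = \<xi> - 2 \<nu> R (y + z)\<close>, where \<open>y\<close> and \<open>z\<close> are exponentially weighted integrals over the future
  and the past, turns after two differentiations into the boundary value problem
  \<open>A f'' = - C f - D\<close>, \<open>A (f' + \<alpha> f) = \<alpha> \<cdot> xbar / \<sigma>\<^sub>S\<close> at \<open>T\<close> and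
  \<open>A (f' + (R - \<alpha>) f) = (\<alpha> \<cdot> xbar + (R - 2 \<alpha>) x\<^sub>0) / \<sigma>\<^sub>S\<close> at \<open>0\<close>; the cases are the signs of
  \<open>C / A\<close>, and the matrices express the two boundary conditions in the respective fundamental system.
  For \<open>\<nu> < 0\<close> the functional is concave.
\<close>

text \<open>The gradient equation is nonlocal: \<open>y\<close> depends on \<open>f\<close> to the
  right of a point, \<open>z\<close> on \<open>f\<close> to its left. Two differentiations remove
  both integrals but lose two constants, which must be recovered as conditions free of unknown
  integrals. At \<open>T\<close> this succeeds because \<open>y\<close> vanishes and
  \<open>z\<close> cancels from g' + \<alpha> g, where g is the gradient. At 0 only \<open>z\<close>
  vanishes, and g(0) = 0 still contains y(0). The combination g' - (\<alpha> - R) g is free of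
  \<open>y\<close>, and g' = - \<alpha> g turns it into (R - 2 \<alpha>) g. So eliminating y(0)
  costs the factor R - 2 \<alpha>: the local condition at 0 expresses g(0) = 0 only when R \<noteq>
  2 \<alpha>. At resonance R = 2 \<alpha> one has C / A = - \<alpha>^2, so resonance occurs only
  among the exponential solutions; there y(0) is computed explicitly instead.\<close>

section \<open>Calculus on an interval: stationarity, orthogonality, first-order equations\<close>

text \<open>The functional is exactly quadratic along every line, so its first variation is an
  algebraic coefficient.\<close>

lemma stationary_quadratic_iff:
  fixes F :: "real \<Rightarrow> real"
  assumes "\<And>e. F e = a + e * b + e\<^sup>2 * c"
  shows "(F has_real_derivative 0) (at 0) \<longleftrightarrow> b = 0"
proof -
  have "F = (\<lambda>e. a + e * b + e\<^sup>2 * c)"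
    using assms by blast
  moreover have "((\<lambda>e. a + e * b + e\<^sup>2 * c) has_real_derivative b) (at 0)"
    by (auto intro!: derivative_eq_intros)
  ultimately have "(F has_real_derivative b) (at 0)"
    by simp
  then show ?thesis
    using DERIV_unique by blast
qed

lemma integral_quadratic:
  fixes P Q S :: "real \<Rightarrow> real"
  assumes "continuous_on {a..b} P" "continuous_on {a..b} Q" "continuous_on {a..b} S"
  shows "integral {a..b} (\<lambda>s. P s + e * Q s + e\<^sup>2 * S s)
       = integral {a..b} P + e * integral {a..b} Q + e\<^sup>2 * integral {a..b} S"
proof (rule integral_unique)
  have "(P has_integral integral {a..b} P) {a..b}"
    "((\<lambda>s. e * Q s) has_integral e * integral {a..b} Q) {a..b}"
    "((\<lambda>s. e\<^sup>2 * S s) has_integral e\<^sup>2 * integral {a..b} S) {a..b}"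
    using assms by (auto intro!: has_integral_mult_right integrable_integral integrable_continuous_interval)
  then show "((\<lambda>s. P s + e * Q s + e\<^sup>2 * S s) has_integral
      integral {a..b} P + e * integral {a..b} Q + e\<^sup>2 * integral {a..b} S) {a..b}"
    by (intro has_integral_add)
qed

lemma integral_mult_eq_0:
  fixes g e :: "real \<Rightarrow> real"
  assumes "\<And>s. s \<in> S \<Longrightarrow> g s = 0"
  shows "integral S (\<lambda>s. g s * e s) = 0"
  using integral_cong[of S "\<lambda>s. g s * e s" "\<lambda>_. 0"] assms by simp

lemma integral_nonpos_continuous:
  fixes f :: "real \<Rightarrow> real"
  assumes "continuous_on {a..b} f" "\<And>s. s \<in> {a..b} \<Longrightarrow> f s \<le> 0"
  shows "integral {a..b} f \<le> 0"
  using integral_le[of f "{a..b}" "\<lambda>_. 0"] assms by (simp add: integrable_continuous_interval)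

text \<open>All continuous functions are admissible directions, so \<open>g\<close> can be tested
  against itself; a continuous nonnegative function with integral 0 vanishes.\<close>

lemma continuous_orthogonal_eq_0:
  fixes g :: "real \<Rightarrow> real"
  assumes "a < b" "continuous_on {a..b} g"
    and "\<And>e. continuous_on {a..b} e \<Longrightarrow> integral {a..b} (\<lambda>s. g s * e s) = 0"
    and "s \<in> {a..b}"
  shows "g s = 0"
proof -
  have "integral {a..b} (\<lambda>s. g s * g s) = 0"
    using assms by blast
  moreover have "continuous_on {a..b} (\<lambda>s. g s * g s)"
    using assms by (intro continuous_intros)
  ultimately have "\<forall>s\<in>{a..b}. g s * g s = 0"
    using integral_eq_0_iff[of a b "\<lambda>s. g s * g s"] \<open>a < b\<close> by simp
  then show ?thesis
    using \<open>s \<in> {a..b}\<close> by simp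
qed

text \<open>The integrating factor makes \<open>w s * exp (- q * s)\<close> constant, so a zero at
  any point \<open>t\<close> propagates in both directions. It is applied with \<open>t = T\<close>
  and with \<open>t = 0\<close>.\<close>

lemma linear_first_order_eq_0:
  fixes w :: "real \<Rightarrow> real"
  assumes w: "\<And>s. s \<in> {a..b} \<Longrightarrow> (w has_real_derivative q * w s) (at s within {a..b})"
    and "t \<in> {a..b}" "w t = 0" "s \<in> {a..b}"
  shows "w s = 0"
proof -
  have "((\<lambda>s. w s * exp (- q * s)) has_real_derivative 0) (at s within {a..b})"
    if "s \<in> {a..b}" for s
    by (rule derivative_eq_intros w that refl | simp)+
  then obtain c where "\<And>s. s \<in> {a..b} \<Longrightarrow> w s * exp (- q * s) = c"
    using has_field_derivative_zero_constant[of "{a..b}" "\<lambda>s. w s * exp (- q * s)"]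
    by (auto simp: convex_real_interval)
  with assms show ?thesis
    by (metis exp_not_eq_zero mult_eq_0_iff)
qed

subsection \<open>Linear second-order equations\<close>

text \<open>A first-order system on the closed interval. The derivative \<open>k\<close> is carried
  as an argument because the boundary conditions evaluate it at the endpoints, where only the
  derivative within the interval is meaningful.\<close>

definition ode_sol :: "real \<Rightarrow> real \<Rightarrow> real \<Rightarrow> (real \<Rightarrow> real) \<Rightarrow> (real \<Rightarrow> real) \<Rightarrow> bool" where
  "ode_sol T q d f k \<longleftrightarrow> (\<forall>s\<in>{0..T}.
     (f has_real_derivative k s) (at s within {0..T}) \<and>
     (k has_real_derivative q * f s + d) (at s within {0..T}))"

text \<open>The energy \<open>g\<^sup>2 + k\<^sup>2\<close> satisfies Gronwall's inequality.\<close>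

lemma ode_sol_zero:
  assumes sol: "ode_sol T q 0 g k" and "g 0 = 0" "k 0 = 0" and s: "s \<in> {0..T}"
  shows "g s = 0 \<and> k s = 0"
proof -
  \<comment> \<open>The derivative of the energy is \<open>2 * (1 + q) * g s * k s\<close>, which is
    at most \<open>\<bar>1 + q\<bar>\<close> times the energy.\<close>
  define L where "L = \<bar>1 + q\<bar>"
  define E where "E s = ((g s)\<^sup>2 + (k s)\<^sup>2) * exp (- L * s)" for s
  define E' where "E' s = (2 * (1 + q) * g s * k s - L * ((g s)\<^sup>2 + (k s)\<^sup>2)) * exp (- L * s)" for s
  have E: "(E has_real_derivative E' u) (at u within {0..T})" if "u \<in> {0..T}" for u
  proof -
    have d: "(g has_real_derivative k u) (at u within {0..T})"
      "(k has_real_derivative q * g u + 0) (at u within {0..T})"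
      using sol that by (auto simp: ode_sol_def)
    show ?thesis
      unfolding E_def E'_def
      by (rule derivative_eq_intros d refl | simp add: algebra_simps power2_eq_square)+
  qed
  have neg: "E' u \<le> 0" for u
  proof -
    have "2 * (1 + q) * g u * k u = 2 * ((1 + q) * (g u * k u))"
      by simp
    also have "\<dots> \<le> 2 * \<bar>(1 + q) * (g u * k u)\<bar>"
      by simp
    also have "\<dots> = L * (2 * \<bar>g u * k u\<bar>)"
      by (simp add: L_def abs_mult)
    also have "\<dots> \<le> L * ((g u)\<^sup>2 + (k u)\<^sup>2)"
      using sum_squares_bound[of "\<bar>g u\<bar>" "\<bar>k u\<bar>"]
      by (intro mult_left_mono) (auto simp: L_def abs_mult)
    finally show ?thesis
      by (simp add: E'_def mult_le_0_iff)
  qed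
  have "E s \<le> E 0"
  proof (rule DERIV_nonpos_imp_decreasing_open[of 0 s E])
    show "\<exists>y. (E has_real_derivative y) (at x) \<and> y \<le> 0" if "0 < x" "x < s" for x
      using E[of x] neg[of x] that s by (auto simp: at_within_Icc_at)
    show "continuous_on {0..s} E"
      using E s by (intro continuous_on_subset[OF DERIV_continuous_on[of "{0..T}"]]) auto
  qed (use s in auto)
  then have "(g s)\<^sup>2 + (k s)\<^sup>2 \<le> 0"
    using assms by (simp add: E_def mult_le_0_iff)
  then show ?thesis
    using sum_power2_le_zero_iff by blast
qed

text \<open>\<open>W\<close> is the Wronskian at 0. If it is nonzero, some combination matches the
  values of \<open>f\<close> and \<open>k\<close> at 0, and the remainder solves the homogeneous
  system with zero initial data. Both \<open>f\<close> and \<open>k\<close> are described, since the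
  boundary conditions involve both.\<close>

lemma ode_sol_iff_basis:
  assumes "0 \<le> T"
    and p0: "ode_sol T q d p0 p0'" and p1: "ode_sol T q 0 p1 p1'" and p2: "ode_sol T q 0 p2 p2'"
    and W: "p1 0 * p2' 0 - p2 0 * p1' 0 \<noteq> 0"
  shows "ode_sol T q d f k \<longleftrightarrow>
    (\<exists>b1 b2. \<forall>s\<in>{0..T}. f s = p0 s + b1 * p1 s + b2 * p2 s \<and> k s = p0' s + b1 * p1' s + b2 * p2' s)"
    (is "_ \<longleftrightarrow> ?R")
proof
  assume f: "ode_sol T q d f k"
  define W where "W = p1 0 * p2' 0 - p2 0 * p1' 0"
  \<comment> \<open>Cramer's rule for the coefficients that match \<open>f 0\<close> and
    \<open>k 0\<close>.\<close>
  define b1 where "b1 = ((f 0 - p0 0) * p2' 0 - p2 0 * (k 0 - p0' 0)) / W"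
  define b2 where "b2 = (p1 0 * (k 0 - p0' 0) - (f 0 - p0 0) * p1' 0) / W"
  define g where "g s = f s - (p0 s + b1 * p1 s + b2 * p2 s)" for s
  define h where "h s = k s - (p0' s + b1 * p1' s + b2 * p2' s)" for s
  have "ode_sol T q 0 g h"
    unfolding ode_sol_def
  proof
    fix s assume s: "s \<in> {0..T}"
    have d: "(f has_real_derivative k s) (at s within {0..T})"
      "(k has_real_derivative q * f s + d) (at s within {0..T})"
      "(p0 has_real_derivative p0' s) (at s within {0..T})"
      "(p0' has_real_derivative q * p0 s + d) (at s within {0..T})"
      "(p1 has_real_derivative p1' s) (at s within {0..T})"
      "(p1' has_real_derivative q * p1 s + 0) (at s within {0..T})"
      "(p2 has_real_derivative p2' s) (at s within {0..T})"
      "(p2' has_real_derivative q * p2 s + 0) (at s within {0..T})"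
      using s f p0 p1 p2 by (auto simp: ode_sol_def)
    show "(g has_real_derivative h s) (at s within {0..T}) \<and>
        (h has_real_derivative q * g s + 0) (at s within {0..T})"
      unfolding g_def h_def
      by (rule conjI; (rule derivative_eq_intros d refl | simp add: algebra_simps)+)
  qed
  moreover have "W * g 0 = 0" "W * h 0 = 0"
  proof -
    have Wb: "W * b1 = (f 0 - p0 0) * p2' 0 - p2 0 * (k 0 - p0' 0)"
      "W * b2 = p1 0 * (k 0 - p0' 0) - (f 0 - p0 0) * p1' 0"
      using W by (simp_all add: b1_def b2_def flip: W_def)
    have "W * g 0 = W * (f 0 - p0 0) - (W * b1) * p1 0 - (W * b2) * p2 0"
      "W * h 0 = W * (k 0 - p0' 0) - (W * b1) * p1' 0 - (W * b2) * p2' 0"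
      by (simp_all add: g_def h_def algebra_simps)
    then show "W * g 0 = 0" "W * h 0 = 0"
      unfolding Wb by (simp_all add: W_def algebra_simps)
  qed
  with W have "g 0 = 0" "h 0 = 0"
    by (simp_all add: W_def)
  ultimately have "\<forall>s\<in>{0..T}. g s = 0 \<and> h s = 0"
    using ode_sol_zero by blast
  then show ?R
    unfolding g_def h_def by (intro exI[of _ b1] exI[of _ b2]) auto
next
  assume ?R
  then obtain b1 b2 where b: "\<And>s. s \<in> {0..T} \<Longrightarrow> f s = p0 s + b1 * p1 s + b2 * p2 s"
    "\<And>s. s \<in> {0..T} \<Longrightarrow> k s = p0' s + b1 * p1' s + b2 * p2' s"
    by blast
  show "ode_sol T q d f k"
    unfolding ode_sol_def
  proof
    fix s assume s: "s \<in> {0..T}"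
    have d:
      "(p0 has_real_derivative p0' s) (at s within {0..T})"
      "(p0' has_real_derivative q * p0 s + d) (at s within {0..T})"
      "(p1 has_real_derivative p1' s) (at s within {0..T})"
      "(p1' has_real_derivative q * p1 s + 0) (at s within {0..T})"
      "(p2 has_real_derivative p2' s) (at s within {0..T})"
      "(p2' has_real_derivative q * p2 s + 0) (at s within {0..T})"
      using s p0 p1 p2 by (auto simp: ode_sol_def)
    have "((\<lambda>s. p0 s + b1 * p1 s + b2 * p2 s) has_real_derivative k s) (at s within {0..T})"
      by (rule derivative_eq_intros d refl | simp add: b[OF s] algebra_simps)+
    moreover have "((\<lambda>s. p0' s + b1 * p1' s + b2 * p2' s) has_real_derivative q * f s + d)
        (at s within {0..T})"
      by (rule derivative_eq_intros d refl | simp add: b[OF s] algebra_simps)+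
    ultimately show "(f has_real_derivative k s) (at s within {0..T}) \<and>
        (k has_real_derivative q * f s + d) (at s within {0..T})"
      using s b has_field_derivative_transform_within[OF _ zero_less_one s] by (metis (no_types, lifting))
  qed
qed

subsection \<open>Exponentially weighted integrals\<close>

definition past :: "real \<Rightarrow> (real \<Rightarrow> real) \<Rightarrow> real \<Rightarrow> real" where
  "past a h s = integral {0..s} (\<lambda>u. h u * exp (- a * (s - u)))"

definition future :: "real \<Rightarrow> real \<Rightarrow> (real \<Rightarrow> real) \<Rightarrow> real \<Rightarrow> real" where
  "future a T f u = integral {u..T} (\<lambda>s. f s * exp (- a * (s - u)))"

lemma past_0 [simp]: "past a h 0 = 0"
  by (simp add: past_def)

lemma future_end [simp]: "future a T f T = 0"
  by (simp add: future_def)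

text \<open>The kernel factors as \<open>exp (- a * s) * exp (a * u)\<close>, so \<open>s\<close>
  leaves the integrand and the product rule with the fundamental theorem applies.\<close>

lemma past_has_derivative:
  assumes "continuous_on {0..T} h" and s: "s \<in> {0..T}"
  shows "(past a h has_real_derivative h s - a * past a h s) (at s within {0..T})"
proof -
  have eq: "past a h = (\<lambda>s. exp (- a * s) * integral {0..s} (\<lambda>u. h u * exp (a * u)))"
    unfolding past_def integral_mult_right[symmetric]
  proof (intro ext integral_cong)
    fix s u
    have "exp (- a * (s - u)) = exp (- a * s) * exp (a * u)"
      by (simp add: right_diff_distrib flip: exp_add)
    then show "h u * exp (- a * (s - u)) = exp (- a * s) * (h u * exp (a * u))"
      by simp
  qed
  have d: "((\<lambda>s. integral {0..s} (\<lambda>u. h u * exp (a * u))) has_real_derivative h s * exp (a * s))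
      (at s within {0..T})"
    by (rule integral_has_real_derivative) (use assms in \<open>auto intro!: continuous_intros\<close>)
  show ?thesis
    unfolding eq
    by (rule DERIV_cong[OF DERIV_mult[OF _ d, of _ "- a * exp (- a * s)"]])
       (auto intro!: derivative_eq_intros simp: exp_minus)
qed

lemma future_has_derivative:
  assumes "continuous_on {0..T} f" and s: "s \<in> {0..T}"
  shows "(future a T f has_real_derivative a * future a T f s - f s) (at s within {0..T})"
proof -
  have eq: "future a T f = (\<lambda>s. exp (a * s) * integral {s..T} (\<lambda>u. f u * exp (- a * u)))"
    unfolding future_def integral_mult_right[symmetric]
  proof (intro ext integral_cong)
    fix s u
    have "exp (- a * (u - s)) = exp (a * s) * exp (- a * u)"
      by (simp add: right_diff_distrib flip: exp_add)
    then show "f u * exp (- a * (u - s)) = exp (a * s) * (f u * exp (- a * u))"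
      by simp
  qed
  have d: "((\<lambda>s. integral {s..T} (\<lambda>u. f u * exp (- a * u))) has_real_derivative - (f s * exp (- a * s)))
      (at s within {0..T})"
    by (rule integral_has_real_derivative') (use assms in \<open>auto intro!: continuous_intros\<close>)
  show ?thesis
    unfolding eq
    by (rule DERIV_cong[OF DERIV_mult[OF _ d, of _ "a * exp (a * s)"]])
       (auto intro!: derivative_eq_intros simp: exp_minus)
qed

lemma continuous_on_past:
  "continuous_on {0..T} h \<Longrightarrow> continuous_on {0..T} (past a h)"
  using past_has_derivative by (intro DERIV_continuous_on) blast

lemma continuous_on_future:
  "continuous_on {0..T} f \<Longrightarrow> continuous_on {0..T} (future a T f)"
  using future_has_derivative by (intro DERIV_continuous_on) blast

text \<open>Integration by parts: \<open>past a h * future a T e\<close> vanishes at both ends of the interval.\<close>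

lemma past_future_adjoint:
  assumes "0 \<le> T" and h: "continuous_on {0..T} h" and e: "continuous_on {0..T} e"
  shows "integral {0..T} (\<lambda>u. h u * future a T e u) = integral {0..T} (\<lambda>s. past a h s * e s)"
proof -
  have "((\<lambda>s. h s * future a T e s - past a h s * e s) has_integral
      past a h T * future a T e T - past a h 0 * future a T e 0) {0..T}"
  proof (rule fundamental_theorem_of_calculus)
    fix s assume s: "s \<in> {0..T}"
    show "((\<lambda>s. past a h s * future a T e s) has_vector_derivative
        h s * future a T e s - past a h s * e s) (at s within {0..T})"
      unfolding has_real_derivative_iff_has_vector_derivative[symmetric]
      by (rule DERIV_cong[OF DERIV_mult[OF past_has_derivative[OF h s] future_has_derivative[OF e s]]])
         (simp add: algebra_simps)
  qed (use assms in auto)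
  then have "integral {0..T} (\<lambda>s. h s * future a T e s - past a h s * e s) = 0"
    by (simp add: integral_unique)
  moreover have "integral {0..T} (\<lambda>s. h s * future a T e s - past a h s * e s)
      = integral {0..T} (\<lambda>s. h s * future a T e s) - integral {0..T} (\<lambda>s. past a h s * e s)"
    using h e by (intro integral_diff integrable_continuous_interval continuous_intros
        continuous_on_past continuous_on_future)
  ultimately show ?thesis by simp
qed

lemma future_linear:
  assumes "continuous_on {0..T} f" "continuous_on {0..T} e" "u \<in> {0..T}"
  shows "future a T (\<lambda>s. f s + c * e s) u = future a T f u + c * future a T e u"
proof -
  have "continuous_on {u..T} f" "continuous_on {u..T} e"
    using assms by (auto intro: continuous_on_subset)
  then have "integral {u..T} (\<lambda>s. f s * exp (- a * (s - u)) + c * (e s * exp (- a * (s - u))))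
      = integral {u..T} (\<lambda>s. f s * exp (- a * (s - u))) + integral {u..T} (\<lambda>s. c * (e s * exp (- a * (s - u))))"
    by (intro integral_add integrable_continuous_interval continuous_intros)
  then show ?thesis
    by (simp add: future_def algebra_simps)
qed

subsection \<open>Gradients and optimality\<close>

definition equity_dev :: "market \<Rightarrow> real \<Rightarrow> (real \<Rightarrow> real) \<Rightarrow> real \<Rightarrow> real" where
  "equity_dev p T f u = f u - sigma_x p / sigma_S p * future (alpha p) T f u"

text \<open>With F the future operator and P its adjoint, the past operator, this is
  \<open>xi\<close> - f + 2 \<nu> (1 - R P) (1 - R F) f.\<close>

definition equity_grad :: "market \<Rightarrow> real \<Rightarrow> real \<Rightarrow> (real \<Rightarrow> real) \<Rightarrow> real \<Rightarrow> real" where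
  "equity_grad p T \<nu> f s = xi p s - f s
     + 2 * \<nu> * (equity_dev p T f s - sigma_x p / sigma_S p * past (alpha p) (equity_dev p T f) s)"

definition rate_grad :: "market \<Rightarrow> real \<Rightarrow> real \<Rightarrow> (real \<Rightarrow> real) \<Rightarrow> real \<Rightarrow> real" where
  "rate_grad p T \<nu> f s =
     lambda_r p + 2 * \<nu> * sigma_r p * Psi (kappa p) (T - s) - (1 - 2 * \<nu>) * f s"

lemma continuous_on_xi [continuous_intros]: "continuous_on S (xi p)"
  unfolding xi_def by (intro continuous_intros)

lemma continuous_on_equity_dev:
  "continuous_on {0..T} f \<Longrightarrow> continuous_on {0..T} (equity_dev p T f)"
  unfolding equity_dev_def by (intro continuous_intros continuous_on_future)

lemma continuous_on_equity_grad:
  "continuous_on {0..T} f \<Longrightarrow> continuous_on {0..T} (equity_grad p T \<nu> f)"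
  unfolding equity_grad_def
  by (intro continuous_intros continuous_on_past continuous_on_equity_dev)

lemma continuous_on_Psi: "continuous_on {0..T} (Psi k)"
  unfolding Psi_def
  by (intro indefinite_integral_continuous_1 integrable_continuous_interval continuous_intros)

lemma continuous_on_Psi_diff: "continuous_on {0..T} (\<lambda>s. Psi k (T - s))"
  by (intro continuous_on_compose2[OF continuous_on_Psi] continuous_intros) auto

lemma Psi_0 [simp]: "Psi k 0 = 0"
  by (simp add: Psi_def)

lemma Psi_neq_0: "Psi k T \<noteq> 0" if "0 < T"
proof -
  have "continuous_on {0..T} (\<lambda>u. exp (- k * u))"
    by (intro continuous_intros)
  from integral_eq_0_iff[OF this that] that show ?thesis
    by (auto simp: Psi_def)
qed

lemma continuous_on_rate_grad:
  "continuous_on {0..T} f \<Longrightarrow> continuous_on {0..T} (rate_grad p T \<nu> f)"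
  unfolding rate_grad_def by (intro continuous_intros continuous_on_Psi_diff)

text \<open>The expansion is exact in \<open>c\<close>: its linear term identifies the gradient, and
  its quadratic term later carries the concavity argument.\<close>

lemma equity_expansion:
  assumes T: "0 \<le> T" and f: "continuous_on {0..T} f" and e: "continuous_on {0..T} e"
  shows "equity_mean p T (\<lambda>s. f s + c * e s) + \<nu> * equity_var p T (\<lambda>s. f s + c * e s)
    = equity_mean p T f + \<nu> * equity_var p T f
      + c * integral {0..T} (\<lambda>s. equity_grad p T \<nu> f s * e s)
      + c\<^sup>2 * integral {0..T} (\<lambda>s. - (e s)\<^sup>2 / 2 + \<nu> * (equity_dev p T e s)\<^sup>2)"
proof -
  let ?h = "equity_dev p T f" and ?R = "sigma_x p / sigma_S p"
  let ?P = "\<lambda>f s. xi p s * f s - 1 / 2 * (f s)\<^sup>2" and ?V = "\<lambda>f s. (equity_dev p T f s)\<^sup>2"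
  have comb: "equity_mean p T g + \<nu> * equity_var p T g = integral {0..T} (\<lambda>s. ?P g s + \<nu> * ?V g s)"
    if g: "continuous_on {0..T} g" for g
  proof -
    have "integral {0..T} (\<lambda>s. ?P g s + \<nu> * ?V g s)
        = integral {0..T} (?P g) + integral {0..T} (\<lambda>s. \<nu> * ?V g s)"
      using g by (intro integral_add integrable_continuous_interval continuous_intros
          continuous_on_equity_dev)
    then show ?thesis
      by (simp add: equity_mean_def equity_var_def equity_dev_def future_def)
  qed
  have "integral {0..T} (\<lambda>s. ?P (\<lambda>s. f s + c * e s) s + \<nu> * ?V (\<lambda>s. f s + c * e s) s)
      = integral {0..T} (\<lambda>s. (?P f s + \<nu> * ?V f s)
          + c * ((xi p s - f s) * e s + 2 * \<nu> * (?h s * equity_dev p T e s))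
          + c\<^sup>2 * (- (e s)\<^sup>2 / 2 + \<nu> * ?V e s))"
  proof (rule integral_cong)
    fix s assume "s \<in> {0..T}"
    then have "equity_dev p T (\<lambda>s. f s + c * e s) s = ?h s + c * equity_dev p T e s"
      using future_linear[OF f e] by (simp add: equity_dev_def algebra_simps)
    then show "?P (\<lambda>s. f s + c * e s) s + \<nu> * ?V (\<lambda>s. f s + c * e s) s
        = (?P f s + \<nu> * ?V f s)
          + c * ((xi p s - f s) * e s + 2 * \<nu> * (?h s * equity_dev p T e s))
          + c\<^sup>2 * (- (e s)\<^sup>2 / 2 + \<nu> * ?V e s)"
      by (simp add: power2_eq_square field_simps)
  qed
  also have "\<dots> = integral {0..T} (\<lambda>s. ?P f s + \<nu> * ?V f s)
      + c * integral {0..T} (\<lambda>s. (xi p s - f s) * e s + 2 * \<nu> * (?h s * equity_dev p T e s))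
      + c\<^sup>2 * integral {0..T} (\<lambda>s. - (e s)\<^sup>2 / 2 + \<nu> * ?V e s)"
    using f e by (intro integral_quadratic continuous_intros continuous_on_equity_dev) auto
  also have "integral {0..T} (\<lambda>s. (xi p s - f s) * e s + 2 * \<nu> * (?h s * equity_dev p T e s))
      = integral {0..T} (\<lambda>s. equity_grad p T \<nu> f s * e s)"
  proof -
    let ?z = "past (alpha p) ?h" and ?y = "future (alpha p) T e"
    have h: "continuous_on {0..T} ?h"
      using f by (rule continuous_on_equity_dev)
    \<comment> \<open>The two candidate linear terms differ by \<open>2 * \<nu> * ?R\<close> times
      the integral of \<open>?z s * e s - ?h s * ?y s\<close>, which vanishes by
      adjointness.\<close>
    have "integral {0..T} (\<lambda>s. (xi p s - f s) * e s + 2 * \<nu> * (?h s * equity_dev p T e s))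
        - integral {0..T} (\<lambda>s. equity_grad p T \<nu> f s * e s)
        = integral {0..T} (\<lambda>s. (xi p s - f s) * e s + 2 * \<nu> * (?h s * equity_dev p T e s)
            - equity_grad p T \<nu> f s * e s)"
      using f e h by (intro integral_diff[symmetric] integrable_continuous_interval
          continuous_intros continuous_on_equity_dev continuous_on_equity_grad)
    also have "\<dots> = integral {0..T} (\<lambda>s. 2 * \<nu> * ?R * (?z s * e s - ?h s * ?y s))"
      by (intro integral_cong) (simp add: equity_grad_def equity_dev_def[of _ _ e] algebra_simps)
    also have "\<dots> = 2 * \<nu> * ?R * integral {0..T} (\<lambda>s. ?z s * e s - ?h s * ?y s)"
      by (rule integral_mult_right)
    also have "integral {0..T} (\<lambda>s. ?z s * e s - ?h s * ?y s)
        = integral {0..T} (\<lambda>s. ?z s * e s) - integral {0..T} (\<lambda>s. ?h s * ?y s)"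
      using h e by (intro integral_diff integrable_continuous_interval continuous_intros
          continuous_on_past continuous_on_future)
    also have "\<dots> = 0"
      using past_future_adjoint[OF T h e] by simp
    finally show ?thesis by simp
  qed
  finally show ?thesis
    using f e by (simp add: comb continuous_intros)
qed

lemma rate_expansion:
  assumes f: "continuous_on {0..T} f" and e: "continuous_on {0..T} e"
  shows "rate_mean p T (\<lambda>s. f s + c * e s) + \<nu> * rate_var p T (\<lambda>s. f s + c * e s)
    = rate_mean p T f + \<nu> * rate_var p T f
      + c * integral {0..T} (\<lambda>s. rate_grad p T \<nu> f s * e s)
      + c\<^sup>2 * integral {0..T} (\<lambda>s. (\<nu> - 1 / 2) * (e s)\<^sup>2)"
proof -
  let ?P = "\<lambda>f s. lambda_r p * f s - 1 / 2 * (f s)\<^sup>2"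
    and ?V = "\<lambda>f s. (sigma_r p * Psi (kappa p) (T - s) + f s)\<^sup>2"
  have comb: "rate_mean p T g + \<nu> * rate_var p T g = integral {0..T} (\<lambda>s. ?P g s + \<nu> * ?V g s)"
    if g: "continuous_on {0..T} g" for g
  proof -
    have "integral {0..T} (\<lambda>s. ?P g s + \<nu> * ?V g s)
        = integral {0..T} (?P g) + integral {0..T} (\<lambda>s. \<nu> * ?V g s)"
      using g by (intro integral_add integrable_continuous_interval continuous_intros
          continuous_on_Psi_diff)
    then show ?thesis
      by (simp add: rate_mean_def rate_var_def)
  qed
  have "integral {0..T} (\<lambda>s. ?P (\<lambda>s. f s + c * e s) s + \<nu> * ?V (\<lambda>s. f s + c * e s) s)
      = integral {0..T} (\<lambda>s. (?P f s + \<nu> * ?V f s)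
          + c * (rate_grad p T \<nu> f s * e s) + c\<^sup>2 * ((\<nu> - 1 / 2) * (e s)\<^sup>2))"
    by (intro integral_cong) (simp add: rate_grad_def power2_eq_square field_simps)
  also have "\<dots> = integral {0..T} (\<lambda>s. ?P f s + \<nu> * ?V f s)
      + c * integral {0..T} (\<lambda>s. rate_grad p T \<nu> f s * e s)
      + c\<^sup>2 * integral {0..T} (\<lambda>s. (\<nu> - 1 / 2) * (e s)\<^sup>2)"
    using f e
    by (intro integral_quadratic continuous_intros continuous_on_Psi_diff continuous_on_rate_grad)
  finally show ?thesis
    using f e by (simp add: comb continuous_intros)
qed

section \<open>Stationarity as pointwise vanishing of the gradients\<close>

lemma extremal_equity_iff_grad:
  assumes "0 < T"
  shows "extremal_equity_strategy p T \<nu> f \<longleftrightarrow>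
    continuous_on {0..T} f \<and> (\<forall>s\<in>{0..T}. equity_grad p T \<nu> f s = 0)"
proof (cases "continuous_on {0..T} f")
  case True
  have "extremal_equity_strategy p T \<nu> f \<longleftrightarrow>
      (\<forall>e. continuous_on {0..T} e \<longrightarrow> integral {0..T} (\<lambda>s. equity_grad p T \<nu> f s * e s) = 0)"
    using stationary_quadratic_iff[OF equity_expansion[OF _ True]] assms True
    by (simp add: extremal_equity_strategy_def)
  also have "\<dots> \<longleftrightarrow> (\<forall>s\<in>{0..T}. equity_grad p T \<nu> f s = 0)"
  proof
    assume "\<forall>e. continuous_on {0..T} e \<longrightarrow> integral {0..T} (\<lambda>s. equity_grad p T \<nu> f s * e s) = 0"
    then show "\<forall>s\<in>{0..T}. equity_grad p T \<nu> f s = 0"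
      using continuous_orthogonal_eq_0[OF assms continuous_on_equity_grad[OF True]] by blast
  next
    assume "\<forall>s\<in>{0..T}. equity_grad p T \<nu> f s = 0"
    then show "\<forall>e. continuous_on {0..T} e \<longrightarrow> integral {0..T} (\<lambda>s. equity_grad p T \<nu> f s * e s) = 0"
      by (auto intro!: integral_mult_eq_0)
  qed
  finally show ?thesis
    using True by simp
qed (simp add: extremal_equity_strategy_def)

text \<open>Serves twice: with \<open>c\<close> as the variation parameter for stationarity, and
  with \<open>c = 1\<close> and a difference of two pairs for global comparison.\<close>

lemma objective_expansion:
  assumes "0 \<le> T" and fr: "continuous_on {0..T} fr" and fS: "continuous_on {0..T} fS"
    and er: "continuous_on {0..T} er" and eS: "continuous_on {0..T} eS"
  shows "mu p T (\<lambda>s. fr s + c * er s) (\<lambda>s. fS s + c * eS s)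
      + \<nu> * sigma2 p T (\<lambda>s. fr s + c * er s) (\<lambda>s. fS s + c * eS s)
    = (mu p T fr fS + \<nu> * sigma2 p T fr fS)
      + c * (integral {0..T} (\<lambda>s. rate_grad p T \<nu> fr s * er s)
             + integral {0..T} (\<lambda>s. equity_grad p T \<nu> fS s * eS s))
      + c\<^sup>2 * (integral {0..T} (\<lambda>s. (\<nu> - 1 / 2) * (er s)\<^sup>2)
             + integral {0..T} (\<lambda>s. - (eS s)\<^sup>2 / 2 + \<nu> * (equity_dev p T eS s)\<^sup>2))"
  using rate_expansion[OF fr er, of p c \<nu>] equity_expansion[OF \<open>0 \<le> T\<close> fS eS, of p c \<nu>]
  by (simp add: mu_def sigma2_def algebra_simps)

text \<open>The expansion has no cross terms between the two risks, so the conditions decouple; only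
  the common \<open>\<nu>\<close> links them.\<close>

lemma lagrange_multiplier_iff_grad:
  assumes "0 < T" and "strategy_pair T fr fS"
  shows "lagrange_multiplier p T fr fS \<nu> \<longleftrightarrow>
    (\<forall>s\<in>{0..T}. rate_grad p T \<nu> fr s = 0) \<and> (\<forall>s\<in>{0..T}. equity_grad p T \<nu> fS s = 0)"
proof -
  have c: "continuous_on {0..T} fr" "continuous_on {0..T} fS"
    using assms by (auto simp: strategy_pair_def)
  let ?I = "\<lambda>er eS. integral {0..T} (\<lambda>s. rate_grad p T \<nu> fr s * er s)
             + integral {0..T} (\<lambda>s. equity_grad p T \<nu> fS s * eS s)"
  have "lagrange_multiplier p T fr fS \<nu> \<longleftrightarrow>
      (\<forall>er eS. continuous_on {0..T} er \<and> continuous_on {0..T} eS \<longrightarrow> ?I er eS = 0)"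
    using stationary_quadratic_iff[OF objective_expansion[OF less_imp_le[OF \<open>0 < T\<close>] c]]
    by (simp add: lagrange_multiplier_def strategy_pair_def)
  also have "\<dots> \<longleftrightarrow> (\<forall>s\<in>{0..T}. rate_grad p T \<nu> fr s = 0) \<and> (\<forall>s\<in>{0..T}. equity_grad p T \<nu> fS s = 0)"
  proof
    assume I: "\<forall>er eS. continuous_on {0..T} er \<and> continuous_on {0..T} eS \<longrightarrow> ?I er eS = 0"
    \<comment> \<open>Setting one of the two directions to zero isolates the other gradient.\<close>
    have "integral {0..T} (\<lambda>s. rate_grad p T \<nu> fr s * e s) = 0" if "continuous_on {0..T} e" for e
      using I[rule_format, of e "\<lambda>_. 0"] that by simp
    moreover have "integral {0..T} (\<lambda>s. equity_grad p T \<nu> fS s * e s) = 0"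
      if "continuous_on {0..T} e" for e
      using I[rule_format, of "\<lambda>_. 0" e] that by simp
    ultimately show "(\<forall>s\<in>{0..T}. rate_grad p T \<nu> fr s = 0) \<and> (\<forall>s\<in>{0..T}. equity_grad p T \<nu> fS s = 0)"
      using continuous_orthogonal_eq_0[OF \<open>0 < T\<close> continuous_on_rate_grad[OF c(1)]]
        continuous_orthogonal_eq_0[OF \<open>0 < T\<close> continuous_on_equity_grad[OF c(2)]] by blast
  next
    assume "(\<forall>s\<in>{0..T}. rate_grad p T \<nu> fr s = 0) \<and> (\<forall>s\<in>{0..T}. equity_grad p T \<nu> fS s = 0)"
    then have "integral {0..T} (\<lambda>s. rate_grad p T \<nu> fr s * er s) = 0"
      "integral {0..T} (\<lambda>s. equity_grad p T \<nu> fS s * eS s) = 0" for er eS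
      by (auto intro!: integral_mult_eq_0)
    then show "\<forall>er eS. continuous_on {0..T} er \<and> continuous_on {0..T} eS \<longrightarrow> ?I er eS = 0"
      by simp
  qed
  finally show ?thesis .
qed

section \<open>The rate equation and uniqueness of the multiplier\<close>

lemma rate_grad_eq_0_iff:
  "rate_grad p T \<nu> f s = 0 \<longleftrightarrow>
    f s = (lambda_r p + 2 * \<nu> * sigma_r p * Psi (kappa p) (T - s)) / (1 - 2 * \<nu>)"
  if "\<nu> \<noteq> 1 / 2"
  using that by (auto simp: rate_grad_def field_simps)

text \<open>For \<open>\<nu> = 1 / 2\<close> the rate equation would make \<open>\<lambda>\<^sup>r + \<sigma>\<^sub>r \<Psi>(\<kappa>, \<cdot>)\<close> vanish on \<open>[0, T]\<close>.\<close>

lemma rate_affine_not_identically_0: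
  assumes "0 < T" "0 < sigma_r p"
  shows "\<exists>s\<in>{0..T}. lambda_r p + sigma_r p * Psi (kappa p) (T - s) \<noteq> 0"
\<comment> \<open>Two endpoints suffice as witnesses: at \<open>s = T\<close> the \<open>Psi\<close>
  term vanishes and leaves \<open>lambda_r p\<close>; if that is 0, then at \<open>s = 0\<close> the
  nonzero \<open>Psi (kappa p) T\<close> remains.\<close>
proof (cases "lambda_r p = 0")
  case True
  with assms show ?thesis
    by (intro bexI[of _ 0]) (simp_all add: Psi_neq_0)
next
  case False
  with assms show ?thesis
    by (intro bexI[of _ T]) simp_all
qed

lemma rate_grad_multiplier_neq_half:
  assumes "0 < T" "0 < sigma_r p" "\<And>s. s \<in> {0..T} \<Longrightarrow> rate_grad p T \<nu> f s = 0"
  shows "\<nu> \<noteq> 1 / 2"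
  using rate_affine_not_identically_0[OF assms(1,2)] assms(3) by (force simp: rate_grad_def)

text \<open>Subtracting the equations for two multipliers makes the integrand of the rate variance
  vanish; either equation then reduces to
  \<open>lambda_r p + sigma_r p * Psi (kappa p) (T - s) = 0\<close>, which fails at some
  \<open>s\<close>. Uniqueness matters because \<open>positive_tradeoff\<close> quantifies over all
  multipliers.\<close>

lemma rate_grad_multiplier_unique:
  assumes "0 < T" "0 < sigma_r p" "\<And>s. s \<in> {0..T} \<Longrightarrow> rate_grad p T \<nu> f s = 0"
    "\<And>s. s \<in> {0..T} \<Longrightarrow> rate_grad p T \<nu>' f s = 0"
  shows "\<nu> = \<nu>'"
proof (rule ccontr)
  assume "\<nu> \<noteq> \<nu>'"
  obtain s where s: "s \<in> {0..T}" "lambda_r p + sigma_r p * Psi (kappa p) (T - s) \<noteq> 0"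
    using rate_affine_not_identically_0[OF assms(1,2)] by blast
  have "2 * (\<nu> - \<nu>') * (sigma_r p * Psi (kappa p) (T - s) + f s)
      = rate_grad p T \<nu> f s - rate_grad p T \<nu>' f s"
    by (simp add: rate_grad_def algebra_simps)
  then have "f s = - (sigma_r p * Psi (kappa p) (T - s))"
    using \<open>\<nu> \<noteq> \<nu>'\<close> assms(3,4)[OF s(1)] by simp
  with assms(3)[OF s(1)] s(2) show False
    by (simp add: rate_grad_def algebra_simps)
qed

lemma extremal_pair_iff:
  assumes "0 < T" "0 < sigma_r p"
  shows "extremal_pair p T fr fS \<longleftrightarrow> (\<exists>\<nu>. \<nu> \<noteq> 1/2 \<and>
          (\<forall>s\<in>{0..T}. fr s =
             (lambda_r p + 2 * \<nu> * sigma_r p * Psi (kappa p) (T - s)) / (1 - 2 * \<nu>)) \<and>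
          extremal_equity_strategy p T \<nu> fS)" (is "_ \<longleftrightarrow> (\<exists>\<nu>. _ \<and> (\<forall>s\<in>_. fr s = ?F \<nu> s) \<and> _)")
proof
  assume "extremal_pair p T fr fS"
  then obtain \<nu> where sp: "strategy_pair T fr fS" and "lagrange_multiplier p T fr fS \<nu>"
    by (auto simp: extremal_pair_def)
  then have g: "\<And>s. s \<in> {0..T} \<Longrightarrow> rate_grad p T \<nu> fr s = 0" "\<forall>s\<in>{0..T}. equity_grad p T \<nu> fS s = 0"
    using lagrange_multiplier_iff_grad[OF \<open>0 < T\<close> sp] by auto
  have "\<nu> \<noteq> 1/2"
    using rate_grad_multiplier_neq_half assms g(1) by blast
  then show "\<exists>\<nu>. \<nu> \<noteq> 1/2 \<and> (\<forall>s\<in>{0..T}. fr s = ?F \<nu> s) \<and> extremal_equity_strategy p T \<nu> fS"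
    using g sp rate_grad_eq_0_iff extremal_equity_iff_grad[OF \<open>0 < T\<close>]
    by (auto simp: strategy_pair_def)
next
  assume "\<exists>\<nu>. \<nu> \<noteq> 1/2 \<and> (\<forall>s\<in>{0..T}. fr s = ?F \<nu> s) \<and> extremal_equity_strategy p T \<nu> fS"
  then obtain \<nu> where \<nu>: "\<nu> \<noteq> 1/2" "\<And>s. s \<in> {0..T} \<Longrightarrow> fr s = ?F \<nu> s"
    "extremal_equity_strategy p T \<nu> fS"
    by blast
  \<comment> \<open>Continuity of \<open>fr\<close> has to be read off the formula, since the
    right-hand side only prescribes its values.\<close>
  have "continuous_on {0..T} (?F \<nu>)"
    using \<nu>(1) by (intro continuous_intros continuous_on_Psi_diff) auto
  then have "continuous_on {0..T} fr"
    using \<nu>(2) continuous_on_cong[of "{0..T}" "{0..T}" fr "?F \<nu>"] by simp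
  then have "strategy_pair T fr fS"
    using \<nu>(3) extremal_equity_iff_grad[OF \<open>0 < T\<close>] by (simp add: strategy_pair_def)
  moreover have "lagrange_multiplier p T fr fS \<nu>"
    using lagrange_multiplier_iff_grad[OF \<open>0 < T\<close> calculation] \<nu> rate_grad_eq_0_iff
      extremal_equity_iff_grad[OF \<open>0 < T\<close>] by simp
  ultimately show "extremal_pair p T fr fS"
    by (auto simp: extremal_pair_def)
qed

text \<open>For \<open>\<nu> < 0\<close> the functional \<open>\<mu> + \<nu> \<sigma>\<^sup>2\<close> is concave, so a stationary point is a global maximum.\<close>

lemma optimal_pair_of_negative_multiplier:
  assumes "0 < T" "\<nu> < 0" "strategy_pair T fr fS" "lagrange_multiplier p T fr fS \<nu>"
  shows "optimal_pair p T fr fS"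
  unfolding optimal_pair_def
proof (intro conjI allI impI)
  fix gr gS assume g: "strategy_pair T gr gS" and eq: "sigma2 p T gr gS = sigma2 p T fr fS"
  have c: "continuous_on {0..T} fr" "continuous_on {0..T} fS"
    "continuous_on {0..T} gr" "continuous_on {0..T} gS"
    using assms g by (auto simp: strategy_pair_def)
  let ?er = "\<lambda>s. gr s - fr s" and ?eS = "\<lambda>s. gS s - fS s"
  have e: "continuous_on {0..T} ?er" "continuous_on {0..T} ?eS"
    using c by (auto intro: continuous_intros)
  have "integral {0..T} (\<lambda>s. rate_grad p T \<nu> fr s * ?er s) = 0"
    "integral {0..T} (\<lambda>s. equity_grad p T \<nu> fS s * ?eS s) = 0"
    using lagrange_multiplier_iff_grad[OF assms(1,3)] assms(4) by (auto intro!: integral_mult_eq_0)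
  moreover have "integral {0..T} (\<lambda>s. (\<nu> - 1 / 2) * (?er s)\<^sup>2) \<le> 0"
    using \<open>\<nu> < 0\<close> c
    by (intro integral_nonpos_continuous continuous_intros) (simp_all add: mult_nonpos_nonneg)
  moreover have "integral {0..T} (\<lambda>s. - (?eS s)\<^sup>2 / 2 + \<nu> * (equity_dev p T ?eS s)\<^sup>2) \<le> 0"
  proof (rule integral_nonpos_continuous)
    show "continuous_on {0..T} (\<lambda>s. - (?eS s)\<^sup>2 / 2 + \<nu> * (equity_dev p T ?eS s)\<^sup>2)"
      using c e by (intro continuous_intros continuous_on_equity_dev) auto
    show "- (?eS s)\<^sup>2 / 2 + \<nu> * (equity_dev p T ?eS s)\<^sup>2 \<le> 0" for s
      using \<open>\<nu> < 0\<close> by (intro add_nonpos_nonpos mult_nonpos_nonneg) simp_all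
  qed
  \<comment> \<open>At \<open>c = 1\<close> the perturbed pair is the competitor itself: the linear
    term is 0 and the quadratic one nonpositive. Equal variances then cancel the
    \<open>\<nu>\<close> terms.\<close>
  ultimately have "mu p T gr gS + \<nu> * sigma2 p T gr gS \<le> mu p T fr fS + \<nu> * sigma2 p T fr fS"
    using objective_expansion[OF less_imp_le[OF \<open>0 < T\<close>] c(1,2) e, of p 1 \<nu>] by simp
  with eq show "mu p T gr gS \<le> mu p T fr fS" by simp
qed (use assms in simp)

lemma positive_tradeoff_of_negative_multiplier:
  assumes "0 < T" "0 < sigma_r p" "\<nu> < 0" "strategy_pair T fr fS" "lagrange_multiplier p T fr fS \<nu>"
  shows "positive_tradeoff p T fr fS"
  unfolding positive_tradeoff_def extremal_pair_def
  using assms rate_grad_multiplier_unique[OF assms(1,2)] lagrange_multiplier_iff_grad[OF assms(1,4)]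
  by (metis neg_0_less_iff_less)

subsection \<open>The equity boundary value problem\<close>

lemma ode_sol_continuous_on:
  assumes "ode_sol T q d f k" shows "continuous_on {0..T} f"
  using assms by (auto simp: ode_sol_def intro!: DERIV_continuous_on)

text \<open>
  With \<open>y\<close> and \<open>z\<close> the future and past integrals, the gradient equation reads
  \<open>A f = \<xi> - 2 \<nu> R (y + z)\<close>, and \<open>(y + z)'' = \<alpha>\<^sup>2 (y + z) - (2 \<alpha> - R) f\<close>; differentiating twice
  gives the equation for \<open>f\<close>.  Conversely, for a solution of that equation the gradient
  \<open>g\<close> satisfies \<open>g'' = \<alpha>\<^sup>2 g\<close> and, by the terminal condition, \<open>g' + \<alpha> g = 0\<close> at \<open>T\<close> and hence everywhere.
\<close>

lemma
  fixes p :: market and T \<nu> :: real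
  defines "a \<equiv> alpha p" and "R \<equiv> sigma_x p / sigma_S p"
  defines "A \<equiv> 1 - 2 * \<nu>" and "C \<equiv> 2 * \<nu> * (a - R)\<^sup>2 - a\<^sup>2" and "D \<equiv> a\<^sup>2 * xbar p / sigma_S p"
  assumes S: "0 < sigma_S p" and T: "0 < T" and A: "A \<noteq> 0"
  shows equity_grad_eq_0_iff_ode: "(continuous_on {0..T} f \<and> (\<forall>s\<in>{0..T}. equity_grad p T \<nu> f s = 0)) \<longleftrightarrow>
    (\<exists>k. ode_sol T (- C / A) (- D / A) f k \<and>
       A * (k T + a * f T) = a * xbar p / sigma_S p \<and> equity_grad p T \<nu> f 0 = 0)"
    (is "?L \<longleftrightarrow> ?R")
  and equity_grad_initial:
    "\<lbrakk>ode_sol T (- C / A) (- D / A) f k; A * (k T + a * f T) = a * xbar p / sigma_S p\<rbrakk> \<Longrightarrow>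
      (R - 2 * a) * equity_grad p T \<nu> f 0
      = a * xbar p / sigma_S p + (R - 2 * a) * xinit p / sigma_S p - A * (k 0 + (R - a) * f 0)"
proof -
  define x where "x s = - a * exp (- a * s) * (xinit p - xbar p) / sigma_S p" for s
  have dxi: "(xi p has_real_derivative x s) (at s within {0..T})" for s
    unfolding x_def xi_def a_def using S by (auto intro!: derivative_eq_intros)
  have dx: "(x has_real_derivative a\<^sup>2 * xi p s - D) (at s within {0..T})" for s
    unfolding x_def xi_def a_def D_def using S
    by (auto intro!: derivative_eq_intros simp: power2_eq_square diff_divide_distrib add_divide_distrib algebra_simps)
  have x_xi: "x s + a * xi p s = a * xbar p / sigma_S p" for s
    unfolding x_def xi_def a_def by (simp add: diff_divide_distrib add_divide_distrib algebra_simps)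
  define y where "y = future a T f"
  define z where "z = past a (equity_dev p T f)"
  have grad: "equity_grad p T \<nu> f s = xi p s - A * f s - 2 * \<nu> * R * (y s + z s)" for s
    unfolding equity_grad_def equity_dev_def[of p T f s] y_def z_def A_def R_def a_def
    by (simp add: algebra_simps)
  \<comment> \<open>The candidate for f', from differentiating
    \<open>A f = xi - 2 \<nu> R (y + z)\<close>. In y' + z' the terms in \<open>f\<close> cancel and
    leave \<open>(a - R) * y s - a * z s\<close>, which is again differentiable; hence a merely
    continuous \<open>f\<close> turns out to be twice differentiable.\<close>
  define k0 where "k0 s = (x s - 2 * \<nu> * R * ((a - R) * y s - a * z s)) / A" for s
  have CA: "- C = a\<^sup>2 * A + 2 * \<nu> * R * (2 * a - R)"
    unfolding C_def A_def by (simp add: power2_eq_square algebra_simps)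
  have dy: "(y has_real_derivative a * y s - f s) (at s within {0..T})"
    and dz: "(z has_real_derivative f s - R * y s - a * z s) (at s within {0..T})"
    if "continuous_on {0..T} f" "s \<in> {0..T}" for s
    unfolding y_def z_def using that
    by (auto intro!: DERIV_cong[OF past_has_derivative] future_has_derivative continuous_on_equity_dev
        simp: equity_dev_def a_def R_def)
  have yT: "y T = 0" and z0: "z 0 = 0"
    by (simp_all add: y_def z_def)
  define g where "g s = equity_grad p T \<nu> f s" for s
  \<comment> \<open>The derivative of \<open>g\<close> once \<open>k\<close> is the derivative of
    \<open>f\<close>; as in \<open>k0\<close>, the terms in \<open>f\<close> cancel.\<close>
  define g' where "g' k s = x s - A * k s - 2 * \<nu> * R * ((a - R) * y s - a * z s)" for k s
  have reverse: "continuous_on {0..T} f \<and>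
      (\<forall>s\<in>{0..T}. (g has_real_derivative g' k s) (at s within {0..T}) \<and> g' k s + a * g s = 0)"
    if ode: "ode_sol T (- C / A) (- D / A) f k"
      and kT: "A * (k T + a * f T) = a * xbar p / sigma_S p" for k
  proof -
    have cf: "continuous_on {0..T} f"
      using ode by (rule ode_sol_continuous_on)
    have df: "(f has_real_derivative k s) (at s within {0..T})"
      "(k has_real_derivative - C / A * f s + - D / A) (at s within {0..T})" if "s \<in> {0..T}" for s
      using ode that by (auto simp: ode_sol_def)
    note d = dxi dx dy[OF cf] dz[OF cf] df
    have dg: "(g has_real_derivative g' k s) (at s within {0..T})" if "s \<in> {0..T}" for s
    proof -
      have "(g has_real_derivative
          x s - A * k s - 2 * \<nu> * R * ((a * y s - f s) + (f s - R * y s - a * z s))) (at s within {0..T})"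
        unfolding g_def[abs_def] grad by (intro DERIV_diff DERIV_cmult DERIV_add d that)
      then show ?thesis
        by (rule DERIV_cong) (simp add: g'_def algebra_simps)
    qed
    have dg': "(g' k has_real_derivative a\<^sup>2 * g s) (at s within {0..T})" if "s \<in> {0..T}" for s
    proof -
      have "(g' k has_real_derivative
          a\<^sup>2 * xi p s - D - A * (- C / A * f s + - D / A)
          - 2 * \<nu> * R * ((a - R) * (a * y s - f s) - a * (f s - R * y s - a * z s))) (at s within {0..T})"
        unfolding g'_def[abs_def] by (intro DERIV_diff DERIV_cmult d that)
      moreover have "A * (- C / A * f s + - D / A) = - C * f s - D"
        using A by (simp add: field_simps)
      ultimately show ?thesis
        unfolding CA by (elim DERIV_cong) (simp add: g_def grad power2_eq_square algebra_simps)
    qed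
    have w: "g' k s + a * g s = 0" if "s \<in> {0..T}" for s
    proof (rule linear_first_order_eq_0[where w = "\<lambda>s. g' k s + a * g s" and t = T and b = T])
      show "((\<lambda>s. g' k s + a * g s) has_real_derivative a * (g' k u + a * g u)) (at u within {0..T})"
        if "u \<in> {0..T}" for u
        by (rule DERIV_cong[OF DERIV_add[OF dg' DERIV_cmult[OF dg]]])
           (use that in \<open>simp_all add: power2_eq_square algebra_simps\<close>)
      \<comment> \<open>At \<open>T\<close> the integral \<open>y\<close> is 0, and the
        \<open>z\<close> terms of \<open>g' k T\<close> and \<open>a * g T\<close> cancel, so no
        unknown integral survives.\<close>
      have "g' k T + a * g T = (x T + a * xi p T) - A * (k T + a * f T)"
        by (simp add: g'_def g_def grad yT algebra_simps)
      then show "g' k T + a * g T = 0"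
        by (simp add: kT x_xi)
    qed (use that T in auto)
    then show ?thesis
      using cf dg by blast
  qed
  show "?L \<longleftrightarrow> ?R"
  proof
    assume L: ?L
    then have f: "A * f s = xi p s - 2 * \<nu> * R * (y s + z s)" if "s \<in> {0..T}" for s
      using grad[of s] that by simp
    note d = dxi dx dy[OF conjunct1[OF L]] dz[OF conjunct1[OF L]]
    have "ode_sol T (- C / A) (- D / A) f k0"
      unfolding ode_sol_def
    proof (intro ballI conjI)
      fix s assume s: "s \<in> {0..T}"
      have "((\<lambda>s. (xi p s - 2 * \<nu> * R * (y s + z s)) / A) has_real_derivative
          (x s - 2 * \<nu> * R * ((a * y s - f s) + (f s - R * y s - a * z s))) / A) (at s within {0..T})"
        by (intro DERIV_cdivide DERIV_diff DERIV_cmult DERIV_add d s)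
      then show "(f has_real_derivative k0 s) (at s within {0..T})"
      proof (rule has_field_derivative_transform_within[OF DERIV_cong zero_less_one s])
        fix t assume "t \<in> {0..T}"
        then show "(xi p t - 2 * \<nu> * R * (y t + z t)) / A = f t"
          using f A by (simp add: divide_eq_eq mult.commute)
      qed (simp add: k0_def algebra_simps)
      have "(k0 has_real_derivative
          (a\<^sup>2 * xi p s - D - 2 * \<nu> * R * ((a - R) * (a * y s - f s) - a * (f s - R * y s - a * z s))) / A)
          (at s within {0..T})"
        unfolding k0_def[abs_def] by (intro DERIV_cdivide DERIV_diff DERIV_cmult d s)
      moreover have "a\<^sup>2 * xi p s - D - 2 * \<nu> * R * ((a - R) * (a * y s - f s) - a * (f s - R * y s - a * z s))
          = a\<^sup>2 * (xi p s - 2 * \<nu> * R * (y s + z s)) + 2 * \<nu> * R * (2 * a - R) * f s - D"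
        by (simp add: power2_eq_square algebra_simps)
      moreover have "\<dots> = - C * f s - D"
        unfolding f[OF s, symmetric] CA by (simp add: algebra_simps)
      ultimately show "(k0 has_real_derivative - C / A * f s + - D / A) (at s within {0..T})"
        by (simp add: diff_divide_distrib)
    qed
    moreover have "A * (k0 T + a * f T) = a * xbar p / sigma_S p"
    proof -
      have "A * (k0 T + a * f T) = A * k0 T + a * (A * f T)"
        by (simp add: algebra_simps)
      also have "A * k0 T = x T + 2 * \<nu> * R * (a * z T)"
        using A by (simp add: k0_def yT)
      also have "A * f T = xi p T - 2 * \<nu> * R * z T"
        using f[of T] T by (simp add: yT)
      also have "x T + 2 * \<nu> * R * (a * z T) + a * (xi p T - 2 * \<nu> * R * z T) = x T + a * xi p T"
        by (simp add: algebra_simps)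
      finally show ?thesis by (simp add: x_xi)
    qed
    ultimately show ?R
      using L T by auto
  next
    assume ?R
    then obtain k where ode: "ode_sol T (- C / A) (- D / A) f k"
      and kT: "A * (k T + a * f T) = a * xbar p / sigma_S p" and g0: "equity_grad p T \<nu> f 0 = 0"
      by blast
    note reverse = reverse[OF ode kT]
    \<comment> \<open>Since \<open>g' k s = - a * g s\<close> throughout, the single condition
      \<open>g 0 = 0\<close> makes the whole gradient vanish.\<close>
    have "g s = 0" if "s \<in> {0..T}" for s
    proof (rule linear_first_order_eq_0[where w = g and t = 0 and b = T and q = "- a"])
      show "(g has_real_derivative - a * g u) (at u within {0..T})" if u: "u \<in> {0..T}" for u
      proof (rule DERIV_cong)
        show "(g has_real_derivative g' k u) (at u within {0..T})"
          using reverse u by blast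
        have "g' k u + a * g u = 0"
          using reverse u by blast
        then show "g' k u = - a * g u"
          by linarith
      qed
    qed (use that T g0 in \<open>auto simp: g_def\<close>)
    then show ?L
      using reverse by (simp add: g_def)
  qed
  show "(R - 2 * a) * equity_grad p T \<nu> f 0
      = a * xbar p / sigma_S p + (R - 2 * a) * xinit p / sigma_S p - A * (k 0 + (R - a) * f 0)"
    if "ode_sol T (- C / A) (- D / A) f k" "A * (k T + a * f T) = a * xbar p / sigma_S p"
  proof -
    have "0 \<in> {0..T}"
      using T by simp
    then have "g' k 0 + a * g 0 = 0"
      using reverse[OF that] by blast
    \<comment> \<open>This combination of \<open>g' k 0\<close> and \<open>g 0\<close> is chosen so
      that the unknown \<open>y 0\<close> drops out; \<open>z 0\<close> is zero anyway.\<close>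
    then have "(R - 2 * a) * g 0 = g' k 0 - (a - R) * g 0"
      by algebra
    also have "\<dots> = x 0 + a * xi p 0 + (R - 2 * a) * xi p 0 - A * (k 0 + (R - a) * f 0)"
      by (simp add: g'_def g_def grad z0 algebra_simps)
    finally show ?thesis
      unfolding x_xi by (simp add: g_def xi_def)
  qed
qed

lemma equity_grad_0:
  "equity_grad p T \<nu> f 0 = xinit p / sigma_S p - (1 - 2 * \<nu>) * f 0
     - 2 * \<nu> * (sigma_x p / sigma_S p) * future (alpha p) T f 0"
  by (simp add: equity_grad_def equity_dev_def xi_def algebra_simps)

text \<open>Off resonance the factor \<open>R - 2 * a\<close> in the initial identity can be
  cancelled, so both conditions become local.\<close>

lemma extremal_equity_iff_bvp:
  fixes p :: market and T \<nu> :: real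
  defines "a \<equiv> alpha p" and "R \<equiv> sigma_x p / sigma_S p"
  defines "A \<equiv> 1 - 2 * \<nu>" and "C \<equiv> 2 * \<nu> * (a - R)\<^sup>2 - a\<^sup>2" and "D \<equiv> a\<^sup>2 * xbar p / sigma_S p"
  assumes "0 < sigma_S p" "0 < T" "A \<noteq> 0" and "R \<noteq> 2 * a"
  shows "extremal_equity_strategy p T \<nu> f \<longleftrightarrow>
    (\<exists>k. ode_sol T (- C / A) (- D / A) f k \<and>
       A * (k T + a * f T) = a * xbar p / sigma_S p \<and>
       A * (k 0 + (R - a) * f 0) = a * xbar p / sigma_S p + (R - 2 * a) * xinit p / sigma_S p)"
proof -
  have "equity_grad p T \<nu> f 0 = 0 \<longleftrightarrow>
      A * (k 0 + (R - a) * f 0) = a * xbar p / sigma_S p + (R - 2 * a) * xinit p / sigma_S p"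
    if "ode_sol T (- C / A) (- D / A) f k" "A * (k T + a * f T) = a * xbar p / sigma_S p" for k
  proof -
    have "(R - 2 * a) * equity_grad p T \<nu> f 0
      = a * xbar p / sigma_S p + (R - 2 * a) * xinit p / sigma_S p - A * (k 0 + (R - a) * f 0)"
      using equity_grad_initial[of p T \<nu> f k] that assms by simp
    moreover have "R - 2 * a \<noteq> 0"
      using assms by simp
    ultimately show ?thesis
      by (metis eq_iff_diff_eq_0 mult_eq_0_iff)
  qed
  moreover have "extremal_equity_strategy p T \<nu> f \<longleftrightarrow>
    (\<exists>k. ode_sol T (- C / A) (- D / A) f k \<and>
       A * (k T + a * f T) = a * xbar p / sigma_S p \<and> equity_grad p T \<nu> f 0 = 0)"
    using equity_grad_eq_0_iff_ode[of p T \<nu> f] extremal_equity_iff_grad[of T p \<nu> f] assms by simp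
  ultimately show ?thesis
    by blast
qed

section \<open>Linear systems for the two coefficients\<close>

text \<open>\<open>matrix_inv\<close> is a choice term; invertibility is what makes it a two-sided
  inverse, and both sides are used, one for each direction.\<close>

lemma mat22_vec2_solution:
  fixes m11 m12 m21 m22 v1 v2 x y :: real
  defines "M \<equiv> mat22 m11 m12 m21 m22"
  assumes "invertible M"
  shows "m11 * x + m12 * y = v1 \<and> m21 * x + m22 * y = v2 \<longleftrightarrow>
    x = (matrix_inv M *v vec2 v1 v2) $ 1 \<and> y = (matrix_inv M *v vec2 v1 v2) $ 2"
proof -
  have inv: "M ** matrix_inv M = mat 1" "matrix_inv M ** M = mat 1"
    using someI_ex[OF assms(2)[unfolded invertible_def]] by (simp_all add: matrix_inv_def)
  have "M *v vec2 x y = vec2 v1 v2 \<longleftrightarrow> vec2 x y = matrix_inv M *v vec2 v1 v2"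
    using inv by (metis matrix_vector_mul_assoc matrix_vector_mul_lid)
  then show ?thesis
    by (simp add: M_def mat22_def vec2_def vec_eq_iff forall_2 matrix_vector_mult_def sum_2)
qed

text \<open>Common frame for the nonresonant exponential, trigonometric and quadratic families.
  \<open>rowT\<close> and \<open>row0\<close> are equivalences rather than identities, so a matrix
  row may be a rescaled boundary condition.\<close>

lemma extremal_equity_iff_basis:
  fixes p :: market and T \<nu> :: real
  defines "a \<equiv> alpha p" and "R \<equiv> sigma_x p / sigma_S p"
  defines "A \<equiv> 1 - 2 * \<nu>" and "C \<equiv> 2 * \<nu> * (a - R)\<^sup>2 - a\<^sup>2" and "D \<equiv> a\<^sup>2 * xbar p / sigma_S p"
  assumes "0 < sigma_S p" "0 < T" "A \<noteq> 0" "R \<noteq> 2 * a"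
    and p0: "ode_sol T (- C / A) (- D / A) p0 p0'"
    and p1: "ode_sol T (- C / A) 0 p1 p1'" and p2: "ode_sol T (- C / A) 0 p2 p2'"
    and W: "p1 0 * p2' 0 - p2 0 * p1' 0 \<noteq> 0"
    and M: "invertible (mat22 m11 m12 m21 m22)"
    and rowT: "\<And>x y. A * ((p0' T + x * p1' T + y * p2' T) + a * (p0 T + x * p1 T + y * p2 T))
        = a * xbar p / sigma_S p \<longleftrightarrow> m11 * x + m12 * y = v1"
    and row0: "\<And>x y. A * ((p0' 0 + x * p1' 0 + y * p2' 0) + (R - a) * (p0 0 + x * p1 0 + y * p2 0))
        = a * xbar p / sigma_S p + (R - 2 * a) * xinit p / sigma_S p \<longleftrightarrow> m21 * x + m22 * y = v2"
  defines "b \<equiv> matrix_inv (mat22 m11 m12 m21 m22) *v vec2 v1 v2"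
  shows "extremal_equity_strategy p T \<nu> f \<longleftrightarrow>
    (\<forall>s\<in>{0..T}. f s = p0 s + b $ 1 * p1 s + b $ 2 * p2 s)"
proof -
  have T: "0 \<in> {0..T}" "T \<in> {0..T}"
    using \<open>0 < T\<close> by auto
  have "extremal_equity_strategy p T \<nu> f \<longleftrightarrow>
    (\<exists>k. ode_sol T (- C / A) (- D / A) f k \<and>
       A * (k T + a * f T) = a * xbar p / sigma_S p \<and>
       A * (k 0 + (R - a) * f 0) = a * xbar p / sigma_S p + (R - 2 * a) * xinit p / sigma_S p)"
    using extremal_equity_iff_bvp[of p T \<nu> f] assms by simp
  also have "\<dots> \<longleftrightarrow> (\<exists>k b1 b2. (\<forall>s\<in>{0..T}. f s = p0 s + b1 * p1 s + b2 * p2 s \<and>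
      k s = p0' s + b1 * p1' s + b2 * p2' s) \<and> m11 * b1 + m12 * b2 = v1 \<and> m21 * b1 + m22 * b2 = v2)"
  proof -
    have "A * (k T + a * f T) = a * xbar p / sigma_S p \<and>
       A * (k 0 + (R - a) * f 0) = a * xbar p / sigma_S p + (R - 2 * a) * xinit p / sigma_S p \<longleftrightarrow>
       m11 * b1 + m12 * b2 = v1 \<and> m21 * b1 + m22 * b2 = v2"
      if "\<forall>s\<in>{0..T}. f s = p0 s + b1 * p1 s + b2 * p2 s \<and> k s = p0' s + b1 * p1' s + b2 * p2' s"
      for k b1 b2
      unfolding bspec[OF that T(1), THEN conjunct1] bspec[OF that T(1), THEN conjunct2]
        bspec[OF that T(2), THEN conjunct1] bspec[OF that T(2), THEN conjunct2]
      by (simp only: rowT row0)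
    then show ?thesis
      unfolding ode_sol_iff_basis[OF less_imp_le[OF \<open>0 < T\<close>] p0 p1 p2 W] by blast
  qed
  also have "\<dots> \<longleftrightarrow> (\<exists>k. \<forall>s\<in>{0..T}. f s = p0 s + b $ 1 * p1 s + b $ 2 * p2 s \<and>
      k s = p0' s + b $ 1 * p1' s + b $ 2 * p2' s)"
    unfolding mat22_vec2_solution[OF M] b_def by auto
  \<comment> \<open>The coefficients are now fixed, so a suitable \<open>k\<close> always exists:
    its defining formula.\<close>
  also have "\<dots> \<longleftrightarrow> (\<forall>s\<in>{0..T}. f s = p0 s + b $ 1 * p1 s + b $ 2 * p2 s)"
    by auto
  finally show ?thesis .
qed

subsection \<open>Explicit solutions\<close>

text \<open>Reduces each row of a coefficient matrix to one polynomial identity plus a nonvanishing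
  scaling factor \<open>c\<close>.\<close>

lemma eq_iff_of_scaled_difference:
  fixes l r m v c :: real
  assumes "l - r = c * (m - v)" "c \<noteq> 0"
  shows "l = r \<longleftrightarrow> m = v"
  using assms by (metis eq_iff_diff_eq_0 mult_eq_0_iff)

lemma ode_sol_const: "q * b + d = 0 \<Longrightarrow> ode_sol T q d (\<lambda>_. b) (\<lambda>_. 0)"
  by (simp add: ode_sol_def)

lemma ode_sol_exp: "q = c\<^sup>2 \<Longrightarrow> ode_sol T q 0 (\<lambda>s. exp (c * s)) (\<lambda>s. c * exp (c * s))"
  unfolding ode_sol_def by (auto intro!: derivative_eq_intros simp: power2_eq_square)

lemma ode_sol_sin: "q = - c\<^sup>2 \<Longrightarrow> ode_sol T q 0 (\<lambda>s. sin (c * s)) (\<lambda>s. c * cos (c * s))"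
  unfolding ode_sol_def by (auto intro!: derivative_eq_intros simp: power2_eq_square)

lemma ode_sol_cos: "q = - c\<^sup>2 \<Longrightarrow> ode_sol T q 0 (\<lambda>s. cos (c * s)) (\<lambda>s. - c * sin (c * s))"
  unfolding ode_sol_def by (auto intro!: derivative_eq_intros simp: power2_eq_square)

text \<open>Up to the constants \<open>A\<close> and \<open>R\<close>, the rows of \<open>M\<close>
  are the boundary conditions divided by \<open>c\<^sup>2 - a\<^sup>2\<close> and
  \<open>c\<^sup>2 - (R - a)\<^sup>2\<close>. These factors are common to both exponents because
  \<open>c\<^sup>2 = - C / A\<close> for both; the division turns \<open>c + a\<close> into the
  reciprocal of \<open>c - a\<close>, and \<open>c + (R - a)\<close> into that of
  \<open>c + a - R\<close>.\<close>

lemma extremal_equity_exponential: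
  fixes p :: market and T \<nu> :: real
  defines "a \<equiv> alpha p" and "R \<equiv> sigma_x p / sigma_S p"
  defines "A \<equiv> 1 - 2 * \<nu>" and "C \<equiv> 2 * \<nu> * (a - R)\<^sup>2 - a\<^sup>2" and "D \<equiv> a\<^sup>2 * xbar p / sigma_S p"
  defines "c1 \<equiv> sqrt (- C / A)" and "c2 \<equiv> - sqrt (- C / A)"
  defines "M \<equiv> mat22 (exp (c1 * T) / (c1 - a)) (exp (c2 * T) / (c2 - a))
      (sigma_x p / (sigma_S p * (c1 + a) - sigma_x p)) (sigma_x p / (sigma_S p * (c2 + a) - sigma_x p))"
    and "v \<equiv> vec2 (a * xbar p / (sigma_S p * (a\<^sup>2 - 2 * \<nu> * (a - R)\<^sup>2)))
       (- (xinit p / sigma_S p) + a * xbar p / sigma_S p *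
         ((a - 2 * \<nu> * (a - R)) / (a\<^sup>2 - 2 * \<nu> * (a - R)\<^sup>2)))"
  assumes pos: "0 < sigma_x p" "0 < sigma_S p" "0 < T" and "\<nu> \<noteq> 0"
    and AC: "C < 0 \<and> 0 < A \<or> A < 0 \<and> 0 < C" and "R \<noteq> 2 * a" and M: "invertible M"
  shows "extremal_equity_strategy p T \<nu> f \<longleftrightarrow> (\<forall>s\<in>{0..T}. f s =
     - D / C + (matrix_inv M *v v) $ 1 * exp (c1 * s) + (matrix_inv M *v v) $ 2 * exp (c2 * s))"
proof -
  define K where "K = xbar p / sigma_S p"
  define X where "X = xinit p / sigma_S p"
  have R: "0 < R"
    using pos by (simp add: R_def)
  have [simp]: "A \<noteq> 0" "C \<noteq> 0"
    using AC by auto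
  have Q: "0 < - C / A"
    using AC by (auto simp: divide_less_0_iff)
  have c: "c1\<^sup>2 = - C / A" "c2\<^sup>2 = - C / A" "c1 > 0" "c2 = - c1"
    using Q by (simp_all add: c1_def c2_def)
  note C = C_def[THEN meta_eq_to_obj_eq]
  have Ca: "A * (- C / A - a\<^sup>2) = - (2 * \<nu> * R * (R - 2 * a))"
    by (simp add: right_diff_distrib) (simp add: C A_def power2_eq_square algebra_simps)
  have CR: "A * (- C / A - (R - a)\<^sup>2) = - (R * (R - 2 * a))"
    by (simp add: right_diff_distrib) (simp add: C A_def power2_eq_square algebra_simps)
  \<comment> \<open>By \<open>Ca\<close> and \<open>CR\<close> the factors are proportional to
    \<open>\<nu> * R * (R - 2 * a)\<close> and \<open>R * (R - 2 * a)\<close>. Their being nonzero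
    also keeps the denominators \<open>c - a\<close> and \<open>c + a - R\<close> away from
    0.\<close>
  have Ca0: "- C / A - a\<^sup>2 \<noteq> 0" and CR0: "- C / A - (R - a)\<^sup>2 \<noteq> 0"
    using Ca CR R \<open>\<nu> \<noteq> 0\<close> \<open>R \<noteq> 2 * a\<close> by auto
  have ca: "e * (c + a) = (- C / A - a\<^sup>2) * (e / (c - a))"
    and cR: "c + (R - a) = (- C / A - (R - a)\<^sup>2) / R *
      (sigma_x p / (sigma_S p * (c + a) - sigma_x p))" if "c\<^sup>2 = - C / A" for c e
  proof -
    have "c - a \<noteq> 0"
      using Ca0 that by auto
    moreover have "- C / A - a\<^sup>2 = (c + a) * (c - a)"
      unfolding that[symmetric] by (simp add: power2_eq_square algebra_simps)
    ultimately show "e * (c + a) = (- C / A - a\<^sup>2) * (e / (c - a))"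
      by simp
    have n: "c + a - R \<noteq> 0"
      using CR0 that by (auto simp: algebra_simps)
    have "sigma_x p / (sigma_S p * (c + a) - sigma_x p) = R / (c + a - R)"
    proof -
      have "sigma_x p = sigma_S p * R"
        using pos by (simp add: R_def)
      then show ?thesis
        using pos by (simp flip: right_diff_distrib)
    qed
    moreover have "- C / A - (R - a)\<^sup>2 = (c + (R - a)) * (c + a - R)"
      unfolding that[symmetric] by (simp add: power2_eq_square algebra_simps)
    ultimately show "c + (R - a) = (- C / A - (R - a)\<^sup>2) / R *
      (sigma_x p / (sigma_S p * (c + a) - sigma_x p))"
      using n R by simp
  qed
  have v1: "a * xbar p / (sigma_S p * (a\<^sup>2 - 2 * \<nu> * (a - R)\<^sup>2)) = - a * K / C"
  proof -
    have "a\<^sup>2 - 2 * \<nu> * (a - R)\<^sup>2 = - C"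
      by (simp add: C)
    then show ?thesis
      by (simp add: K_def)
  qed
  have v2: "- (xinit p / sigma_S p) + a * xbar p / sigma_S p *
      ((a - 2 * \<nu> * (a - R)) / (a\<^sup>2 - 2 * \<nu> * (a - R)\<^sup>2)) = - X - a * K * (a - 2 * \<nu> * (a - R)) / C"
  proof -
    have "a\<^sup>2 - 2 * \<nu> * (a - R)\<^sup>2 = - C"
      by (simp add: C)
    then show ?thesis
      by (simp add: K_def X_def)
  qed
  have b0: "- D / C = - (a\<^sup>2 * K / C)"
    by (simp add: D_def K_def)
  show ?thesis
    unfolding M_def v_def
  proof (rule extremal_equity_iff_basis[where p = p and T = T and \<nu> = \<nu> and p0' = "\<lambda>_. 0" and p1' = "\<lambda>s. c1 * exp (c1 * s)"
        and p2' = "\<lambda>s. c2 * exp (c2 * s)", folded a_def R_def, folded A_def C_def D_def])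
    show "ode_sol T (- C / A) (- D / A) (\<lambda>_. - D / C) (\<lambda>_. 0)"
      by (rule ode_sol_const) (simp add: field_simps)
    show "ode_sol T (- C / A) 0 (\<lambda>s. exp (c1 * s)) (\<lambda>s. c1 * exp (c1 * s))"
      "ode_sol T (- C / A) 0 (\<lambda>s. exp (c2 * s)) (\<lambda>s. c2 * exp (c2 * s))"
      by (rule ode_sol_exp, simp add: c)+
    show "exp (c1 * 0) * (c2 * exp (c2 * 0)) - exp (c2 * 0) * (c1 * exp (c1 * 0)) \<noteq> 0"
      using c by simp
    fix x y
    show "A * (0 + x * (c1 * exp (c1 * T)) + y * (c2 * exp (c2 * T))
          + a * (- D / C + x * exp (c1 * T) + y * exp (c2 * T))) = a * xbar p / sigma_S p \<longleftrightarrow>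
        exp (c1 * T) / (c1 - a) * x + exp (c2 * T) / (c2 - a) * y
          = a * xbar p / (sigma_S p * (a\<^sup>2 - 2 * \<nu> * (a - R)\<^sup>2))"
      unfolding v1
    proof (rule eq_iff_of_scaled_difference[where c = "A * (- C / A - a\<^sup>2)"])
      have "A * (0 + x * (c1 * exp (c1 * T)) + y * (c2 * exp (c2 * T))
          + a * (- D / C + x * exp (c1 * T) + y * exp (c2 * T))) - a * xbar p / sigma_S p
        = A * (x * (exp (c1 * T) * (c1 + a)) + y * (exp (c2 * T) * (c2 + a)))
          - (A * a\<^sup>2 / C + 1) * a * K"
        unfolding b0 by (simp add: K_def algebra_simps)
      also have "A * a\<^sup>2 / C + 1 = - (A * (- C / A - a\<^sup>2) / C)"
        by (simp add: field_simps)
      also have "A * (x * (exp (c1 * T) * (c1 + a)) + y * (exp (c2 * T) * (c2 + a)))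
          - - (A * (- C / A - a\<^sup>2) / C) * a * K
        = A * (- C / A - a\<^sup>2) *
          (exp (c1 * T) / (c1 - a) * x + exp (c2 * T) / (c2 - a) * y - - a * K / C)"
      proof -
        have "A * (x * (q * m) + y * (q * n)) - - (A * q / C) * a * K
            = A * q * (m * x + n * y - - a * K / C)" for q m n
          by (simp add: algebra_simps)
        then show ?thesis
          unfolding ca[OF c(1)] ca[OF c(2)] .
      qed
      finally show "A * (0 + x * (c1 * exp (c1 * T)) + y * (c2 * exp (c2 * T))
          + a * (- D / C + x * exp (c1 * T) + y * exp (c2 * T))) - a * xbar p / sigma_S p
        = A * (- C / A - a\<^sup>2) *
          (exp (c1 * T) / (c1 - a) * x + exp (c2 * T) / (c2 - a) * y - - a * K / C)" .
    qed (use Ca0 in simp)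
    show "A * (0 + x * (c1 * exp (c1 * 0)) + y * (c2 * exp (c2 * 0))
          + (R - a) * (- D / C + x * exp (c1 * 0) + y * exp (c2 * 0)))
        = a * xbar p / sigma_S p + (R - 2 * a) * xinit p / sigma_S p \<longleftrightarrow>
        sigma_x p / (sigma_S p * (c1 + a) - sigma_x p) * x
          + sigma_x p / (sigma_S p * (c2 + a) - sigma_x p) * y
          = - (xinit p / sigma_S p) + a * xbar p / sigma_S p *
         ((a - 2 * \<nu> * (a - R)) / (a\<^sup>2 - 2 * \<nu> * (a - R)\<^sup>2))"
      (is "?l = ?r \<longleftrightarrow> ?m1 * x + ?m2 * y = _")
      unfolding v2
    proof (rule eq_iff_of_scaled_difference[where c = "A * (- C / A - (R - a)\<^sup>2) / R"])
      have "?l - ?r = A * (x * (c1 + (R - a)) + y * (c2 + (R - a)))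
          - (A * (R - a) * a / C + 1) * a * K - (R - 2 * a) * X"
        unfolding b0 by (simp add: K_def X_def divide_inverse power2_eq_square algebra_simps)
      \<comment> \<open>The factor \<open>R - 2 * a\<close> splits off, matching the scaling of this
        row and leaving the numerator \<open>a - 2 * \<nu> * (a - R)\<close> of the second
        right-hand entry.\<close>
      also have "A * (R - a) * a / C + 1 = (R - 2 * a) * (a - 2 * \<nu> * (a - R)) / C"
      proof -
        have "A * (R - a) * a + C = (R - 2 * a) * (a - 2 * \<nu> * (a - R))"
          by (simp add: C A_def power2_eq_square algebra_simps)
        then show ?thesis
          by (simp add: field_simps)
      qed
      also have "A * (x * (c1 + (R - a)) + y * (c2 + (R - a)))
        = A * (- C / A - (R - a)\<^sup>2) / R * (?m1 * x + ?m2 * y)"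
        unfolding cR[OF c(1)] cR[OF c(2)] by (simp add: algebra_simps)
      also have "A * (- C / A - (R - a)\<^sup>2) / R * (?m1 * x + ?m2 * y)
          - (R - 2 * a) * (a - 2 * \<nu> * (a - R)) / C * a * K - (R - 2 * a) * X
        = A * (- C / A - (R - a)\<^sup>2) / R *
            (?m1 * x + ?m2 * y - (- X - a * K * (a - 2 * \<nu> * (a - R)) / C))"
      proof -
        have "q * m - r * w / C * a * K - r * X = q * (m - (- X - a * K * w / C))"
          if "q = - r" for q m r w
          using that by (simp add: algebra_simps)
        moreover have "A * (- C / A - (R - a)\<^sup>2) / R = - (R - 2 * a)"
          unfolding CR using R by simp
        ultimately show ?thesis
          by blast
      qed
      finally show "?l - ?r = A * (- C / A - (R - a)\<^sup>2) / R *
            (?m1 * x + ?m2 * y - (- X - a * K * (a - 2 * \<nu> * (a - R)) / C))" .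
    qed (use CR0 R in simp)
  qed (use pos M[unfolded M_def] \<open>R \<noteq> 2 * a\<close> in simp_all)
qed

text \<open>Both rows are the boundary conditions divided by \<open>A\<close>. The entry with
  \<open>xinit p / sigma_x p\<close> arises by writing \<open>R * (R - 2 * a) / A\<close> as
  \<open>c\<^sup>2 + (R - a)\<^sup>2\<close>.\<close>

lemma extremal_equity_trigonometric:
  fixes p :: market and T \<nu> :: real
  defines "a \<equiv> alpha p" and "R \<equiv> sigma_x p / sigma_S p"
  defines "A \<equiv> 1 - 2 * \<nu>" and "C \<equiv> 2 * \<nu> * (a - R)\<^sup>2 - a\<^sup>2" and "D \<equiv> a\<^sup>2 * xbar p / sigma_S p"
  defines "c \<equiv> sqrt (C / A)"
  defines "M \<equiv> mat22 (a * sin (c * T) + c * cos (c * T)) (a * cos (c * T) - c * sin (c * T)) c (R - a)"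
    and "v \<equiv> vec2 (a * xbar p / sigma_S p * (inverse A + a\<^sup>2 * inverse C))
       (xinit p / sigma_x p * (c\<^sup>2 + (R - a)\<^sup>2)
         + a * xbar p / sigma_S p * (inverse A + a * (R - a) * inverse C))"
  assumes pos: "0 < sigma_x p" "0 < sigma_S p" "0 < T"
    and AC: "A < 0 \<and> C < 0 \<or> 0 < A \<and> 0 < C" and M: "invertible M"
  shows "extremal_equity_strategy p T \<nu> f \<longleftrightarrow> (\<forall>s\<in>{0..T}. f s =
     - D / C + (matrix_inv M *v v) $ 1 * sin (c * s) + (matrix_inv M *v v) $ 2 * cos (c * s))"
proof -
  define X where "X = xinit p / sigma_S p"
  have R: "0 < R"
    using pos by (simp add: R_def)
  have A0 [simp]: "A \<noteq> 0" "C \<noteq> 0"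
    using AC by auto
  have Q: "0 < C / A"
    using AC by (auto simp: zero_less_divide_iff)
  have c: "c\<^sup>2 = C / A" "c > 0"
    using Q by (simp_all add: c_def)
  \<comment> \<open>Resonance would give \<open>C / A = - a\<^sup>2\<close>, contradicting the
    common sign of \<open>A\<close> and \<open>C\<close>.\<close>
  have "R \<noteq> 2 * a"
  proof
    assume "R = 2 * a"
    then have "C = - (a\<^sup>2 * A)"
      by (simp add: C_def A_def power2_eq_square algebra_simps)
    then show False
      using Q by (simp add: not_less)
  qed
  have CR: "c\<^sup>2 + (R - a)\<^sup>2 = R * (R - 2 * a) / A"
  proof -
    have "C + (R - a)\<^sup>2 * A = R * (R - 2 * a)"
      by (simp add: C_def A_def power2_eq_square algebra_simps)
    then show ?thesis
      by (simp add: c(1) field_simps)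
  qed
  have v2: "xinit p / sigma_x p * (c\<^sup>2 + (R - a)\<^sup>2) = (R - 2 * a) * X / A"
    unfolding CR using pos by (simp add: R_def X_def)
  have cancel: "A * (m - (w / A + k * (inverse A + z))) = A * m - (w + k * (1 + A * z))" for m w k z
    by (simp add: field_simps)
  show ?thesis
    unfolding M_def v_def
  proof (rule extremal_equity_iff_basis[where p = p and T = T and \<nu> = \<nu>
        and p0' = "\<lambda>_. 0" and p1' = "\<lambda>s. c * cos (c * s)" and p2' = "\<lambda>s. - c * sin (c * s)",
        folded a_def R_def, folded A_def C_def D_def])
    show "ode_sol T (- C / A) (- D / A) (\<lambda>_. - D / C) (\<lambda>_. 0)"
      by (rule ode_sol_const) (simp add: field_simps)
    show "ode_sol T (- C / A) 0 (\<lambda>s. sin (c * s)) (\<lambda>s. c * cos (c * s))"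
      by (rule ode_sol_sin) (simp add: c)
    show "ode_sol T (- C / A) 0 (\<lambda>s. cos (c * s)) (\<lambda>s. - c * sin (c * s))"
      by (rule ode_sol_cos) (simp add: c)
    show "sin (c * 0) * (- c * sin (c * 0)) - cos (c * 0) * (c * cos (c * 0)) \<noteq> 0"
      using c by simp
    fix x y
    show "A * (0 + x * (c * cos (c * T)) + y * (- c * sin (c * T))
          + a * (- D / C + x * sin (c * T) + y * cos (c * T))) = a * xbar p / sigma_S p \<longleftrightarrow>
        (a * sin (c * T) + c * cos (c * T)) * x + (a * cos (c * T) - c * sin (c * T)) * y
          = a * xbar p / sigma_S p * (inverse A + a\<^sup>2 * inverse C)"
      by (rule eq_iff_of_scaled_difference[where c = A])
         (simp_all add: D_def divide_inverse power2_eq_square algebra_simps)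
    show "A * (0 + x * (c * cos (c * 0)) + y * (- c * sin (c * 0))
          + (R - a) * (- D / C + x * sin (c * 0) + y * cos (c * 0)))
        = a * xbar p / sigma_S p + (R - 2 * a) * xinit p / sigma_S p \<longleftrightarrow>
        c * x + (R - a) * y = xinit p / sigma_x p * (c\<^sup>2 + (R - a)\<^sup>2)
         + a * xbar p / sigma_S p * (inverse A + a * (R - a) * inverse C)"
      unfolding v2
      by (rule eq_iff_of_scaled_difference[where c = A], unfold cancel)
         (simp_all add: D_def X_def divide_inverse power2_eq_square algebra_simps)
  qed (use pos M[unfolded M_def] \<open>R \<noteq> 2 * a\<close> in simp_all)
qed

text \<open>With \<open>C = 0\<close> the equation only prescribes a constant second derivative, so
  1 and s span the homogeneous solutions. The second row is the initial condition times
  \<open>R / (A * (R - a))\<close>; here \<open>R = a\<close> is impossible, as \<open>C = 0\<close>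
  would then force \<open>a = 0\<close> and \<open>R = 0\<close>.\<close>

lemma extremal_equity_quadratic:
  fixes p :: market and T \<nu> :: real
  defines "a \<equiv> alpha p" and "R \<equiv> sigma_x p / sigma_S p"
  defines "A \<equiv> 1 - 2 * \<nu>" and "C \<equiv> 2 * \<nu> * (a - R)\<^sup>2 - a\<^sup>2" and "D \<equiv> a\<^sup>2 * xbar p / sigma_S p"
  defines "M \<equiv> mat22 a (T * a + 1) R (sigma_x p / (sigma_x p - sigma_S p * a))"
    and "v \<equiv> vec2 (xbar p * a / (sigma_S p * A) * (1/2 * T\<^sup>2 * a\<^sup>2 + T * a + 1))
       (xinit p / sigma_S p * (R - a) + xbar p * a / (sigma_S p * A) * R * inverse (R - a))"
  assumes pos: "0 < sigma_x p" "0 < sigma_S p" "0 < T"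
    and AC: "C = 0" "A \<noteq> 0" and M: "invertible M"
  shows "extremal_equity_strategy p T \<nu> f \<longleftrightarrow> (\<forall>s\<in>{0..T}. f s =
     (matrix_inv M *v v) $ 1 + (matrix_inv M *v v) $ 2 * s + - D / (2 * A) * s\<^sup>2)"
proof -
  define K where "K = xbar p / sigma_S p"
  define X where "X = xinit p / sigma_S p"
  have R: "0 < R"
    using pos by (simp add: R_def)
  have "R \<noteq> a"
    using AC(1) R by (auto simp: C_def)
  \<comment> \<open>A form of \<open>C = 0\<close>: it excludes resonance and turns the coefficient
    of \<open>X\<close> after rescaling into \<open>R - a\<close>.\<close>
  have RA: "R * (R - 2 * a) = A * (R - a)\<^sup>2"
    using AC(1) by (simp add: C_def A_def power2_eq_square algebra_simps)
  then have "R \<noteq> 2 * a"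
    using \<open>R \<noteq> a\<close> AC(2) by auto
  have m22: "sigma_x p / (sigma_x p - sigma_S p * a) = R / (R - a)"
  proof -
    have "sigma_x p = sigma_S p * R"
      using pos by (simp add: R_def)
    then show ?thesis
      using pos by (simp flip: right_diff_distrib)
  qed
  have "extremal_equity_strategy p T \<nu> f \<longleftrightarrow> (\<forall>s\<in>{0..T}. f s =
     - D / (2 * A) * s\<^sup>2 + (matrix_inv M *v v) $ 1 * 1 + (matrix_inv M *v v) $ 2 * s)"
    unfolding M_def v_def
  proof (rule extremal_equity_iff_basis[where p = p and T = T and \<nu> = \<nu>
        and p0' = "\<lambda>s. - D / A * s" and p1' = "\<lambda>_. 0" and p2' = "\<lambda>_. 1",
        folded a_def R_def, folded A_def C_def D_def])
    show "ode_sol T (- C / A) (- D / A) (\<lambda>s. - D / (2 * A) * s\<^sup>2) (\<lambda>s. - D / A * s)"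
      unfolding ode_sol_def AC(1) by (auto intro!: derivative_eq_intros simp: AC(2))
    show "ode_sol T (- C / A) 0 (\<lambda>_. 1) (\<lambda>_. 0)"
      by (rule ode_sol_const) (simp add: AC(1))
    show "ode_sol T (- C / A) 0 (\<lambda>s. s) (\<lambda>_. 1)"
      unfolding ode_sol_def AC(1) by (auto intro!: derivative_eq_intros)
    fix x y
    show "A * ((- D / A * T + x * 0 + y * 1) + a * (- D / (2 * A) * T\<^sup>2 + x * 1 + y * T))
        = a * xbar p / sigma_S p \<longleftrightarrow>
        a * x + (T * a + 1) * y
          = xbar p * a / (sigma_S p * A) * (1/2 * T\<^sup>2 * a\<^sup>2 + T * a + 1)"
      by (rule eq_iff_of_scaled_difference[where c = A])
         (use pos AC(2) in \<open>simp_all add: D_def power2_eq_square field_simps\<close>)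
    show "A * ((- D / A * 0 + x * 0 + y * 1) + (R - a) * (- D / (2 * A) * 0\<^sup>2 + x * 1 + y * 0))
        = a * xbar p / sigma_S p + (R - 2 * a) * xinit p / sigma_S p \<longleftrightarrow>
        R * x + sigma_x p / (sigma_x p - sigma_S p * a) * y
          = xinit p / sigma_S p * (R - a) + xbar p * a / (sigma_S p * A) * R * inverse (R - a)"
      (is "?l = ?r \<longleftrightarrow> ?m = ?v")
    proof (rule eq_iff_of_scaled_difference[where c = "A * (R - a) / R"])
      have "R * (?l - ?r) = A * (R - a) * (R * x) + A * R * y - a * R * K - (R * (R - 2 * a)) * X"
        by (simp add: K_def X_def power2_eq_square diff_divide_distrib add_divide_distrib algebra_simps)
      also have "\<dots> = A * (R - a) * (R * x + R / (R - a) * y - (X * (R - a) + a * K / A * R * inverse (R - a)))"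
      proof -
        have "A * r * (R * x) + A * R * y - a * R * K - A * r\<^sup>2 * X
            = A * r * (R * x + R / r * y - (X * r + a * K / A * R * inverse r))" if "r \<noteq> 0" for r
          using that AC(2) by (simp add: power2_eq_square field_simps)
        then show ?thesis
          unfolding RA using \<open>R \<noteq> a\<close> by simp
      qed
      also have "X * (R - a) + a * K / A * R * inverse (R - a) = ?v"
        by (simp add: K_def X_def mult.commute)
      also have "R * x + R / (R - a) * y = ?m"
        by (simp add: m22)
      finally show "?l - ?r = A * (R - a) / R * (?m - ?v)"
        using R by (simp add: field_simps)
    qed (use AC(2) \<open>R \<noteq> a\<close> R in simp)
  qed (use pos AC(2) M[unfolded M_def] \<open>R \<noteq> 2 * a\<close> in simp_all)
  then show ?thesis
    by (simp add: algebra_simps)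
qed

section \<open>Zero multiplier and the resonant exponential case\<close>

text \<open>Without the variance term the gradient is \<open>xi p s - f s\<close>, a pointwise
  equation.\<close>

lemma extremal_equity_zero_multiplier:
  assumes "0 < T"
  shows "extremal_equity_strategy p T 0 f \<longleftrightarrow> (\<forall>s\<in>{0..T}. f s =
     xbar p / sigma_S p + exp (- alpha p * s) * ((xinit p - xbar p) / sigma_S p))"
proof -
  have "xi p s = xbar p / sigma_S p + exp (- alpha p * s) * ((xinit p - xbar p) / sigma_S p)" for s
    by (simp add: xi_def add_divide_distrib)
  moreover have "extremal_equity_strategy p T 0 f \<longleftrightarrow> (\<forall>s\<in>{0..T}. f s = xi p s)"
    using extremal_equity_iff_grad[OF assms, of p 0 f]
      continuous_on_cong[of "{0..T}" "{0..T}" f "xi p"] continuous_on_xi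
    by (auto simp: equity_grad_def)
  ultimately show ?thesis
    by simp
qed

text \<open>
  For \<open>\<alpha> = R / 2\<close> the boundary condition at \<open>0\<close> degenerates; the terminal condition already forces
  \<open>b\<^sub>1 = 0\<close>, and \<open>b\<^sub>2\<close> is read off the gradient equation at \<open>0\<close>.
\<close>

lemma extremal_equity_resonant:
  fixes p :: market and T \<nu> :: real
  defines "a \<equiv> alpha p" and "A \<equiv> 1 - 2 * \<nu>" and "K \<equiv> xbar p / sigma_S p"
    and "X \<equiv> xinit p / sigma_S p"
  assumes pos: "0 < sigma_x p" "0 < sigma_S p" "0 < T" and "A \<noteq> 0"
    and R: "sigma_x p / sigma_S p = 2 * a"
    and N: "2 * \<nu> * exp (- 2 * a * T) - 1 \<noteq> 0"
  shows "extremal_equity_strategy p T \<nu> f \<longleftrightarrow> (\<forall>s\<in>{0..T}. f s =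
     K / A + (- X + K * (1 - 4 * \<nu> / A * (exp (- a * T) - 1)))
        / (2 * \<nu> * exp (- 2 * a * T) - 1) * exp (- a * s))"
proof -
  define E where "E = exp (- a * T)"
  define b where "b = (- X + K * (1 - 4 * \<nu> / A * (E - 1))) / (2 * \<nu> * E\<^sup>2 - 1)"
  have E2: "exp (- 2 * a * T) = E\<^sup>2"
    by (simp add: E_def power2_eq_square flip: exp_add)
  have a: "0 < a"
    using pos R by (metis divide_pos_pos zero_less_mult_pos zero_less_numeral)
  have CA: "- (2 * \<nu> * (a - 2 * a)\<^sup>2 - a\<^sup>2) / A = a\<^sup>2"
    using \<open>A \<noteq> 0\<close> by (simp add: A_def power2_eq_square field_simps)
  have DA: "- (a\<^sup>2 * xbar p / sigma_S p) / A = - (a\<^sup>2 * (K / A))"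
    by (simp add: K_def)
  have T: "0 \<in> {0..T}" "T \<in> {0..T}"
    using pos by auto
  have sol: "ode_sol T (a\<^sup>2) (- (a\<^sup>2 * (K / A))) f k \<longleftrightarrow> (\<exists>b1 b2. \<forall>s\<in>{0..T}.
      f s = K / A + b1 * exp (a * s) + b2 * exp (- a * s) \<and>
      k s = 0 + b1 * (a * exp (a * s)) + b2 * (- a * exp (- a * s)))" for k
    using a pos
    by (intro ode_sol_iff_basis[where ?p0' = "\<lambda>_. 0"] ode_sol_const ode_sol_exp) auto
  have grad: "equity_grad p T \<nu> f 0 = X - K - A * b2 + 4 * \<nu> * (K / A) * (E - 1) - 2 * \<nu> * b2 * (1 - E\<^sup>2)"
    if f: "\<And>s. s \<in> {0..T} \<Longrightarrow> f s = K / A + b2 * exp (- a * s)" for b2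
  proof -
    have "future a T f 0 = integral {0..T} (\<lambda>s. (K / A + b2 * exp (- a * s)) * exp (- a * s))"
      unfolding future_def by (intro integral_cong) (simp add: f)
    also have "\<dots> = (- (K / A) * exp (- a * T) / a - b2 * (exp (- a * T))\<^sup>2 / (2 * a))
        - (- (K / A) * exp (- a * 0) / a - b2 * (exp (- a * 0))\<^sup>2 / (2 * a))"
    proof (intro integral_unique fundamental_theorem_of_calculus)
      fix s
      show "((\<lambda>s. - (K / A) * exp (- a * s) / a - b2 * (exp (- a * s))\<^sup>2 / (2 * a)) has_vector_derivative
          (K / A + b2 * exp (- a * s)) * exp (- a * s)) (at s within {0..T})"
        unfolding has_real_derivative_iff_has_vector_derivative[symmetric]
        using a \<open>A \<noteq> 0\<close> by (auto intro!: derivative_eq_intros simp: power2_eq_square field_simps)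
    qed (use pos in simp)
    also have "\<dots> = (K / A) * (1 - E) / a + b2 * (1 - E\<^sup>2) / (2 * a)"
      by (simp add: E_def diff_divide_distrib right_diff_distrib)
    finally have "2 * a * future a T f 0 = 2 * a * ((K / A) * (1 - E) / a + b2 * (1 - E\<^sup>2) / (2 * a))"
      by simp
    also have "\<dots> = 2 * (K / A) * (1 - E) + b2 * (1 - E\<^sup>2)"
      using a by (simp add: distrib_left)
    finally have fut: "2 * a * future a T f 0 = 2 * (K / A) * (1 - E) + b2 * (1 - E\<^sup>2)" .
    have "equity_grad p T \<nu> f 0 = X - A * f 0 - 2 * \<nu> * (2 * a * future a T f 0)"
      using equity_grad_0[of p T \<nu> f] R by (simp add: X_def A_def a_def)
    also have "A * f 0 = K + A * b2"
      using f[OF T(1)] \<open>A \<noteq> 0\<close> by (simp add: distrib_left)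
    finally show ?thesis
      unfolding fut by (simp add: divide_inverse algebra_simps)
  qed
  have grad_iff: "equity_grad p T \<nu> f 0 = 0 \<longleftrightarrow> b2 = b"
    if "\<And>s. s \<in> {0..T} \<Longrightarrow> f s = K / A + b2 * exp (- a * s)" for b2
  proof -
    have "equity_grad p T \<nu> f 0
        = X - K - A * b2 + 4 * \<nu> * (K / A) * (E - 1) - 2 * \<nu> * b2 * (1 - E\<^sup>2)"
      by (rule grad) (rule that)
    \<comment> \<open>The unknown \<open>b2\<close> enters linearly, and combining
      \<open>- A * b2\<close> with the contribution of the future integral leaves the coefficient
      \<open>2 * \<nu> * E\<^sup>2 - 1\<close>; this is where the denominator comes from.\<close>
    also have "\<dots> = (2 * \<nu> * E\<^sup>2 - 1) * b2 - (- X + K * (1 - 4 * \<nu> / A * (E - 1)))"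
    proof -
      have "A * b2 = b2 - 2 * \<nu> * b2"
        by (simp add: A_def algebra_simps)
      then show ?thesis
        by (simp add: divide_inverse algebra_simps)
    qed
    also have "\<dots> = 0 \<longleftrightarrow> b2 = b"
      using N unfolding b_def E2 by (auto simp: eq_divide_eq mult.commute)
    finally show ?thesis .
  qed
  have "extremal_equity_strategy p T \<nu> f \<longleftrightarrow> (\<exists>k. ode_sol T (a\<^sup>2) (- (a\<^sup>2 * (K / A))) f k \<and>
       A * (k T + a * f T) = a * K \<and> equity_grad p T \<nu> f 0 = 0)"
    using equity_grad_eq_0_iff_ode[of p T \<nu> f, folded a_def A_def, unfolded R CA DA]
      extremal_equity_iff_grad[of T p \<nu> f] pos \<open>A \<noteq> 0\<close> by (simp add: K_def)
  also have "\<dots> \<longleftrightarrow> (\<forall>s\<in>{0..T}. f s = K / A + b * exp (- a * s))"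
  proof
    assume "\<exists>k. ode_sol T (a\<^sup>2) (- (a\<^sup>2 * (K / A))) f k \<and>
       A * (k T + a * f T) = a * K \<and> equity_grad p T \<nu> f 0 = 0"
    then obtain k b1 b2 where
      fk: "\<And>s. s \<in> {0..T} \<Longrightarrow> f s = K / A + b1 * exp (a * s) + b2 * exp (- a * s)"
        "\<And>s. s \<in> {0..T} \<Longrightarrow> k s = 0 + b1 * (a * exp (a * s)) + b2 * (- a * exp (- a * s))"
      and kT: "A * (k T + a * f T) = a * K" and g0: "equity_grad p T \<nu> f 0 = 0"
      unfolding sol by blast
    \<comment> \<open>The constant \<open>K / A\<close> accounts for the right-hand side and
      \<open>exp (- a * s)\<close> is annihilated by the terminal operator, so only the growing mode
      is left over.\<close>
    have "A * (k T + a * f T) = 2 * A * a * b1 * exp (a * T) + a * K"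
      using \<open>A \<noteq> 0\<close> unfolding fk[OF T(2)] by (simp add: algebra_simps)
    then have "b1 = 0"
      using kT a \<open>A \<noteq> 0\<close> by simp
    then show "\<forall>s\<in>{0..T}. f s = K / A + b * exp (- a * s)"
      using fk(1) grad_iff[of b2] g0 by simp
  next
    assume f: "\<forall>s\<in>{0..T}. f s = K / A + b * exp (- a * s)"
    define k where "k s = 0 + 0 * (a * exp (a * s)) + b * (- a * exp (- a * s))" for s
    have "ode_sol T (a\<^sup>2) (- (a\<^sup>2 * (K / A))) f k"
      unfolding sol using f by (intro exI[of _ 0] exI[of _ b]) (simp add: k_def)
    moreover have "A * (k T + a * f T) = a * K"
      using f T \<open>A \<noteq> 0\<close> by (simp add: k_def algebra_simps)
    moreover have "equity_grad p T \<nu> f 0 = 0"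
      using grad_iff[of b] f by simp
    ultimately show "\<exists>k. ode_sol T (a\<^sup>2) (- (a\<^sup>2 * (K / A))) f k \<and>
       A * (k T + a * f T) = a * K \<and> equity_grad p T \<nu> f 0 = 0"
      by blast
  qed
  finally show ?thesis
    unfolding b_def E2 by (simp add: E_def)
qed

text \<open>\<open>R = 2 * a\<close> gives \<open>C = - (a\<^sup>2 * A)\<close>, so the exponents
  are plus and minus \<open>a\<close>; \<open>R > 0\<close> makes \<open>a\<close> positive and
  hence the value of the square root.\<close>

lemma extremal_equity_exponential_resonant:
  fixes p :: market and T \<nu> :: real
  defines "a \<equiv> alpha p" and "R \<equiv> sigma_x p / sigma_S p"
  defines "A \<equiv> 1 - 2 * \<nu>" and "C \<equiv> 2 * \<nu> * (a - R)\<^sup>2 - a\<^sup>2" and "D \<equiv> a\<^sup>2 * xbar p / sigma_S p"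
  assumes pos: "0 < sigma_x p" "0 < sigma_S p" "0 < T" and "A \<noteq> 0" and R: "a = 1/2 * R"
  shows "sqrt (- C / A) = a"
    and "2 * \<nu> * exp (- 2 * a * T) - 1 \<noteq> 0 \<Longrightarrow>
      extremal_equity_strategy p T \<nu> f \<longleftrightarrow> (\<forall>s\<in>{0..T}. f s =
        - D / C + 0 * exp (sqrt (- C / A) * s)
        + (- (xinit p / sigma_S p) + xbar p / sigma_S p * (1 - 4 * \<nu> / (1 - 2 * \<nu>) * (exp (- a * T) - 1)))
          / (2 * \<nu> * exp (- 2 * a * T) - 1) * exp (- sqrt (- C / A) * s))"
proof -
  have R2: "R = 2 * a"
    using R by simp
  have "0 < R"
    using pos by (simp add: R_def)
  then have a: "0 < a"
    using R by simp
  have C: "C = - (a\<^sup>2 * A)"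
    by (simp add: C_def R2 A_def power2_eq_square algebra_simps)
  show root: "sqrt (- C / A) = a"
    using a \<open>A \<noteq> 0\<close> by (simp add: C)
  have b0: "- D / C = xbar p / sigma_S p / A"
    using a by (simp add: C D_def)
  assume "2 * \<nu> * exp (- 2 * a * T) - 1 \<noteq> 0"
  then show "extremal_equity_strategy p T \<nu> f \<longleftrightarrow> (\<forall>s\<in>{0..T}. f s =
        - D / C + 0 * exp (sqrt (- C / A) * s)
        + (- (xinit p / sigma_S p) + xbar p / sigma_S p * (1 - 4 * \<nu> / (1 - 2 * \<nu>) * (exp (- a * T) - 1)))
          / (2 * \<nu> * exp (- 2 * a * T) - 1) * exp (- sqrt (- C / A) * s))"
    unfolding root b0 A_def[symmetric]
    using extremal_equity_resonant[OF pos, of \<nu> f, folded a_def R_def, folded A_def, OF \<open>A \<noteq> 0\<close> R2]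
    by simp
qed

theorem theorem3p7:
  fixes p :: market and T :: real
  assumes "sigma_r p > 0" and "sigma_x p > 0" and "sigma_S p > 0" and "T > 0"
  shows
   "(\<forall>fr fS. extremal_pair p T fr fS \<longleftrightarrow>
       (\<exists>\<nu>. \<nu> \<noteq> 1/2 \<and>
          (\<forall>s\<in>{0..T}. fr s =
             (lambda_r p + 2 * \<nu> * sigma_r p * Psi (kappa p) (T - s)) / (1 - 2 * \<nu>)) \<and>
          extremal_equity_strategy p T \<nu> fS))
    \<and>
    (\<forall>\<nu> fS.
      let \<alpha> = alpha p; xb = xbar p; x0 = xinit p; \<sigma>x = sigma_x p; \<sigma>S = sigma_S p;
          R = \<sigma>x / \<sigma>S; R' = R - \<alpha>;
          A = 1 - 2 * \<nu>; C = 2 * \<nu> * (\<alpha> - R)\<^sup>2 - \<alpha>\<^sup>2; D = \<alpha>\<^sup>2 * xb / \<sigma>S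
      in
       (\<nu> = 0 \<longrightarrow>
          (extremal_equity_strategy p T \<nu> fS \<longleftrightarrow>
             (\<forall>s\<in>{0..T}. fS s = xb / \<sigma>S + exp (- \<alpha> * s) * ((x0 - xb) / \<sigma>S))))
       \<and>
       (\<nu> \<noteq> 0 \<and> (C < 0 \<and> 0 < A \<or> A < 0 \<and> 0 < C) \<longrightarrow>
          (let b0 = - D / C; c1 = sqrt (- C / A); c2 = - c1 in
            (\<alpha> \<noteq> (1/2) * R \<longrightarrow>
              (let M = mat22 (exp (c1 * T) / (c1 - \<alpha>)) (exp (c2 * T) / (c2 - \<alpha>))
                             (\<sigma>x / (\<sigma>S * (c1 + \<alpha>) - \<sigma>x)) (\<sigma>x / (\<sigma>S * (c2 + \<alpha>) - \<sigma>x));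
                   v = vec2 (\<alpha> * xb / (\<sigma>S * (\<alpha>\<^sup>2 - 2 * \<nu> * (\<alpha> - R)\<^sup>2)))
                            (- (x0 / \<sigma>S) + \<alpha> * xb / \<sigma>S *
                               ((\<alpha> - 2 * \<nu> * (\<alpha> - R)) / (\<alpha>\<^sup>2 - 2 * \<nu> * (\<alpha> - R)\<^sup>2)));
                   b = matrix_inv M *v v
               in invertible M \<longrightarrow>
                    (extremal_equity_strategy p T \<nu> fS \<longleftrightarrow>
                      (\<forall>s\<in>{0..T}. fS s = b0 + b $ 1 * exp (c1 * s) + b $ 2 * exp (c2 * s)))))
            \<and>
            (\<alpha> = (1/2) * R \<longrightarrow>
              c1 = \<alpha> \<and> c2 = - \<alpha> \<and>
              (let b1 = 0;
                   b2 = (- (x0 / \<sigma>S) + xb / \<sigma>S *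
                           (1 - 4 * \<nu> / (1 - 2 * \<nu>) * (exp (- \<alpha> * T) - 1)))
                        / (2 * \<nu> * exp (- 2 * \<alpha> * T) - 1)
               in 2 * \<nu> * exp (- 2 * \<alpha> * T) - 1 \<noteq> 0 \<longrightarrow>
                    (extremal_equity_strategy p T \<nu> fS \<longleftrightarrow>
                      (\<forall>s\<in>{0..T}. fS s = b0 + b1 * exp (c1 * s) + b2 * exp (c2 * s)))))))
       \<and>
       (A < 0 \<and> C < 0 \<or> 0 < A \<and> 0 < C \<longrightarrow>
          (let b0 = - D / C; c = sqrt (C / A);
               M = mat22 (\<alpha> * sin (c * T) + c * cos (c * T)) (\<alpha> * cos (c * T) - c * sin (c * T))
                         c R';
               v = vec2 (\<alpha> * xb / \<sigma>S * (inverse A + \<alpha>\<^sup>2 * inverse C))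
                        (x0 / \<sigma>x * (c\<^sup>2 + R'\<^sup>2)
                          + \<alpha> * xb / \<sigma>S * (inverse A + \<alpha> * R' * inverse C));
               b = matrix_inv M *v v
           in invertible M \<longrightarrow>
                (extremal_equity_strategy p T \<nu> fS \<longleftrightarrow>
                  (\<forall>s\<in>{0..T}. fS s = b0 + b $ 1 * sin (c * s) + b $ 2 * cos (c * s)))))
       \<and>
       (\<nu> \<noteq> 0 \<and> C = 0 \<and> A \<noteq> 0 \<longrightarrow>
          (let b2 = - D / (2 * A);
               M = mat22 \<alpha> (T * \<alpha> + 1) (\<sigma>x / \<sigma>S) (\<sigma>x / (\<sigma>x - \<sigma>S * \<alpha>));
               v = vec2 (xb * \<alpha> / (\<sigma>S * (1 - 2 * \<nu>)) * ((1/2) * T\<^sup>2 * \<alpha>\<^sup>2 + T * \<alpha> + 1))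
                        (x0 / \<sigma>S * R'
                          + xb * \<alpha> / (\<sigma>S * (1 - 2 * \<nu>)) * (\<sigma>x / \<sigma>S) * inverse R');
               b = matrix_inv M *v v
           in invertible M \<longrightarrow>
                (extremal_equity_strategy p T \<nu> fS \<longleftrightarrow>
                  (\<forall>s\<in>{0..T}. fS s = b $ 1 + b $ 2 * s + b2 * s\<^sup>2)))))
    \<and>
    (\<forall>\<nu> fr fS. \<nu> < 0 \<and>
        (\<forall>s\<in>{0..T}. fr s =
           (lambda_r p + 2 * \<nu> * sigma_r p * Psi (kappa p) (T - s)) / (1 - 2 * \<nu>)) \<and>
        extremal_equity_strategy p T \<nu> fS
        \<longrightarrow> optimal_pair p T fr fS \<and> positive_tradeoff p T fr fS)"
proof (intro conjI allI)
  fix fr fS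
  show "extremal_pair p T fr fS \<longleftrightarrow>
       (\<exists>\<nu>. \<nu> \<noteq> 1/2 \<and>
          (\<forall>s\<in>{0..T}. fr s =
             (lambda_r p + 2 * \<nu> * sigma_r p * Psi (kappa p) (T - s)) / (1 - 2 * \<nu>)) \<and>
          extremal_equity_strategy p T \<nu> fS)"
    using extremal_pair_iff assms by blast
next
  fix \<nu> fr fS
  show "\<nu> < 0 \<and>
        (\<forall>s\<in>{0..T}. fr s =
           (lambda_r p + 2 * \<nu> * sigma_r p * Psi (kappa p) (T - s)) / (1 - 2 * \<nu>)) \<and>
        extremal_equity_strategy p T \<nu> fS
        \<longrightarrow> optimal_pair p T fr fS \<and> positive_tradeoff p T fr fS"
  proof
    assume H: "\<nu> < 0 \<and>
        (\<forall>s\<in>{0..T}. fr s =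
           (lambda_r p + 2 * \<nu> * sigma_r p * Psi (kappa p) (T - s)) / (1 - 2 * \<nu>)) \<and>
        extremal_equity_strategy p T \<nu> fS"
    then have "\<nu> \<noteq> 1/2"
      by simp
    \<comment> \<open>Extremality supplies the continuity of \<open>fr\<close>; that this particular
      \<open>\<nu>\<close> is a multiplier is then read off the two gradients.\<close>
    with H have "extremal_pair p T fr fS"
      using extremal_pair_iff assms by blast
    then have sp: "strategy_pair T fr fS"
      by (simp add: extremal_pair_def)
    have "lagrange_multiplier p T fr fS \<nu>"
      using H lagrange_multiplier_iff_grad[OF \<open>T > 0\<close> sp] rate_grad_eq_0_iff[of \<nu>]
        extremal_equity_iff_grad[OF \<open>T > 0\<close>] by simp
    with H sp show "optimal_pair p T fr fS \<and> positive_tradeoff p T fr fS"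
      using optimal_pair_of_negative_multiplier positive_tradeoff_of_negative_multiplier assms by blast
  qed
next
  fix \<nu> fS
  show "let \<alpha> = alpha p; xb = xbar p; x0 = xinit p; \<sigma>x = sigma_x p; \<sigma>S = sigma_S p;
          R = \<sigma>x / \<sigma>S; R' = R - \<alpha>;
          A = 1 - 2 * \<nu>; C = 2 * \<nu> * (\<alpha> - R)\<^sup>2 - \<alpha>\<^sup>2; D = \<alpha>\<^sup>2 * xb / \<sigma>S
      in
       (\<nu> = 0 \<longrightarrow>
          (extremal_equity_strategy p T \<nu> fS \<longleftrightarrow>
             (\<forall>s\<in>{0..T}. fS s = xb / \<sigma>S + exp (- \<alpha> * s) * ((x0 - xb) / \<sigma>S))))
       \<and>
       (\<nu> \<noteq> 0 \<and> (C < 0 \<and> 0 < A \<or> A < 0 \<and> 0 < C) \<longrightarrow>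
          (let b0 = - D / C; c1 = sqrt (- C / A); c2 = - c1 in
            (\<alpha> \<noteq> (1/2) * R \<longrightarrow>
              (let M = mat22 (exp (c1 * T) / (c1 - \<alpha>)) (exp (c2 * T) / (c2 - \<alpha>))
                             (\<sigma>x / (\<sigma>S * (c1 + \<alpha>) - \<sigma>x)) (\<sigma>x / (\<sigma>S * (c2 + \<alpha>) - \<sigma>x));
                   v = vec2 (\<alpha> * xb / (\<sigma>S * (\<alpha>\<^sup>2 - 2 * \<nu> * (\<alpha> - R)\<^sup>2)))
                            (- (x0 / \<sigma>S) + \<alpha> * xb / \<sigma>S *
                               ((\<alpha> - 2 * \<nu> * (\<alpha> - R)) / (\<alpha>\<^sup>2 - 2 * \<nu> * (\<alpha> - R)\<^sup>2)));
                   b = matrix_inv M *v v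
               in invertible M \<longrightarrow>
                    (extremal_equity_strategy p T \<nu> fS \<longleftrightarrow>
                      (\<forall>s\<in>{0..T}. fS s = b0 + b $ 1 * exp (c1 * s) + b $ 2 * exp (c2 * s)))))
            \<and>
            (\<alpha> = (1/2) * R \<longrightarrow>
              c1 = \<alpha> \<and> c2 = - \<alpha> \<and>
              (let b1 = 0;
                   b2 = (- (x0 / \<sigma>S) + xb / \<sigma>S *
                           (1 - 4 * \<nu> / (1 - 2 * \<nu>) * (exp (- \<alpha> * T) - 1)))
                        / (2 * \<nu> * exp (- 2 * \<alpha> * T) - 1)
               in 2 * \<nu> * exp (- 2 * \<alpha> * T) - 1 \<noteq> 0 \<longrightarrow>
                    (extremal_equity_strategy p T \<nu> fS \<longleftrightarrow>
                      (\<forall>s\<in>{0..T}. fS s = b0 + b1 * exp (c1 * s) + b2 * exp (c2 * s)))))))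
       \<and>
       (A < 0 \<and> C < 0 \<or> 0 < A \<and> 0 < C \<longrightarrow>
          (let b0 = - D / C; c = sqrt (C / A);
               M = mat22 (\<alpha> * sin (c * T) + c * cos (c * T)) (\<alpha> * cos (c * T) - c * sin (c * T))
                         c R';
               v = vec2 (\<alpha> * xb / \<sigma>S * (inverse A + \<alpha>\<^sup>2 * inverse C))
                        (x0 / \<sigma>x * (c\<^sup>2 + R'\<^sup>2)
                          + \<alpha> * xb / \<sigma>S * (inverse A + \<alpha> * R' * inverse C));
               b = matrix_inv M *v v
           in invertible M \<longrightarrow>
                (extremal_equity_strategy p T \<nu> fS \<longleftrightarrow>
                  (\<forall>s\<in>{0..T}. fS s = b0 + b $ 1 * sin (c * s) + b $ 2 * cos (c * s)))))
       \<and>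
       (\<nu> \<noteq> 0 \<and> C = 0 \<and> A \<noteq> 0 \<longrightarrow>
          (let b2 = - D / (2 * A);
               M = mat22 \<alpha> (T * \<alpha> + 1) (\<sigma>x / \<sigma>S) (\<sigma>x / (\<sigma>x - \<sigma>S * \<alpha>));
               v = vec2 (xb * \<alpha> / (\<sigma>S * (1 - 2 * \<nu>)) * ((1/2) * T\<^sup>2 * \<alpha>\<^sup>2 + T * \<alpha> + 1))
                        (x0 / \<sigma>S * R'
                          + xb * \<alpha> / (\<sigma>S * (1 - 2 * \<nu>)) * (\<sigma>x / \<sigma>S) * inverse R');
               b = matrix_inv M *v v
           in invertible M \<longrightarrow>
                (extremal_equity_strategy p T \<nu> fS \<longleftrightarrow>
                  (\<forall>s\<in>{0..T}. fS s = b $ 1 + b $ 2 * s + b2 * s\<^sup>2))))"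
    unfolding Let_def
    apply (intro conjI impI)
    subgoal
      by (simp only: extremal_equity_zero_multiplier[OF \<open>T > 0\<close>])
    subgoal
      by (rule extremal_equity_exponential; (assumption | use assms in auto))
    subgoal
      by (rule extremal_equity_exponential_resonant; (assumption | use assms in auto))
    \<comment> \<open>Here \<open>c2\<close> has been unfolded to the negative of the square root,
      so the claim is the preceding one under \<open>uminus\<close>.\<close>
    subgoal
      by (rule arg_cong[where f = uminus], rule extremal_equity_exponential_resonant;
          (assumption | use assms in auto))
    subgoal
      by (rule extremal_equity_exponential_resonant; (assumption | use assms in auto))
    subgoal
      by (rule extremal_equity_trigonometric; (assumption | use assms in auto))
    subgoal
      by (rule extremal_equity_quadratic; (assumption | use assms in auto))
    done
qed

end
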